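(* Let $p\in[0,1)$ and let $\mathbf{X}=(\mathrm X_i)_{i\ge1}$ be a sequence of i.i.d. random variables such that $\mathbb P(\mathrm X_1=+1)=p$ and $\mathbb P(\mathrm X_1=-1)=1-p$. Then $\mathcal T_\infty(\mathbf{X})$, the almost sure local limit of $(\mathcal T_n(\mathbf{X}))_{n\ge0}$ as $n\to\infty$, has the law of a Bienaymé tree with offspring distribution $\mu$ given by $\mu(k)=(1-p)p^k$ for $k\ge0$.
   Context: $\mathbb N=\{1,2,3,\dots\}$. Uniform attachment with freezing (Algorithm 1). Given a deterministic sequence $\mathbf{x}=(\mathrm x_i)_{i\ge1}\in\{-1,+1\}^{\mathbb N}$, random rooted, vertex-labelled, edge-labelled trees $(\mathcal T_n(\mathbf{x}))_{n\ge0}$ are built jointly and recursively as follows. $\mathcal T_0(\mathbf{x})$ is a single root vertex labelled $a$. For $n\ge1$, if $\mathcal T_{n-1}(\mathbf{x})$ has no vertex labelled $a$, set $\mathcal T_n(\mathbf{x})=\mathcal T_{n-1}(\mathbf{x})$. Otherwise let $V_n$ be a uniformly random vertex labelled $a$ (an "active" vertex) of $\mathcal T_{n-1}(\mathbf{x})$, chosen independently of the previous choices; if $\mathrm x_n=-1$, $\mathcal T_n(\mathbf{x})$ is obtained by replacing the label $a$ of $V_n$ by $n$ (the vertex is "frozen"); if $\mathrm x_n=+1$, $\mathcal T_n(\mathbf{x})$ is obtained by adding an edge labelled $n$ between $V_n$ and a new vertex labelled $a$. For a random sequence $\mathbf{X}$, first sample $\mathbf{X}$ and then, conditionally on $\mathbf{X}$,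 build $(\mathcal T_n(\mathbf{X}))_{n\ge0}$ by this algorithm with $\mathbf{X}$ considered as fixed. Local topology: for a rooted, vertex- and edge-labelled locally finite tree $t$ and $h\in\mathbb N$, $[t]_h$ is the finite tree obtained by keeping only the vertices at distance at most $h$ from the root, the edges between them and their labels; $t_n\to t$ locally iff for every $h\ge1$, $[t_n]_h=[t]_h$ for all $n$ large enough. Plane trees: let $\mathcal U=\bigcup_{n\ge0}\mathbb N^n$ be the set of finite words of positive integers, $\mathbb N^0=\{\varnothing\}$. A plane tree is a subset $\tau\subset\mathcal U$ such that $\varnothing\in\tau$; if $uj\in\tau$ with $j\in\mathbb N$ then $u\in\tau$; and for every $u\in\tau$ there is an integer $k_u(\tau)\ge0$ such that, for $j\in\mathbb N$, $uj\in\tau$ iff $1\le j\le k_u(\tau)$. For $u\in\tau$, $\theta_u\tau=\{v\in\mathcal U: uv\in\tau\}$. The law $\mathbb P_\mu$ of a Bienaymé (Galton–Watson) tree with offspring distribution $\mu$ is the probability measure on plane trees characterized by: $\mathbb P_\mu(k_\varnothing=j)=\mu(j)$ for $j\ge0$; and for every $j\ge1$ with $\mu(j)>0$, under $\mathbb P_\mu(\cdot\mid k_\varnothing=j)$ the trees $\theta_1\tau,\dots,\theta_j\tau$ are independent with law $\mathbb P_\mu$. The labelled tree $\mathcal T_\infty(\mathbf{X})$ is viewed as a plane tree by ordering the children of each vertex so that the labels of the edges connecting the vertex to its children increase from left to right, and then erasing all labels. *)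

theory Defs
  imports "HOL-Probability.Probability"
begin

datatype vlabel = Active | Frozen nat

text \<open>
  A rooted vertex- and edge-labelled tree in which the edges from a vertex to its children
  carry distinct labels is encoded by naming each vertex by the word of edge labels read along
  the path from the root: the root is \<open>[]\<close>, and the edge labelled \<open>n\<close> below \<open>u\<close> leads to
  \<open>u @ [n]\<close>. The map sends each vertex to its label. Two such trees are isomorphic (as rooted
  labelled trees) iff their encodings are equal, and the length of a word is the distance of
  the vertex to the root.
\<close>

type_synonym ltree = "nat list \<rightharpoonup> vlabel"

definition lf_tree :: "ltree \<Rightarrow> bool" where
  "lf_tree t \<longleftrightarrow> [] \<in> dom t \<and> (\<forall>u n. u @ [n] \<in> dom t \<longrightarrow> u \<in> dom t) \<and>
     (\<forall>u. finite {n. u @ [n] \<in> dom t})"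

definition active :: "ltree \<Rightarrow> nat list set" where
  "active t = {u. t u = Some Active}"

definition ball_of :: "nat \<Rightarrow> ltree \<Rightarrow> ltree" where
  "ball_of h t = t |` {u. length u \<le> h}"

definition converges_locally :: "(nat \<Rightarrow> ltree) \<Rightarrow> ltree \<Rightarrow> bool" where
  "converges_locally T t \<longleftrightarrow>
     lf_tree t \<and> (\<forall>h\<ge>1. \<forall>\<^sub>F n in sequentially. ball_of h (T n) = ball_of h t)"

text \<open>The local limit is unique when it exists; otherwise it is set to the one-vertex tree, by
  convention.\<close>

definition local_limit :: "(nat \<Rightarrow> ltree) \<Rightarrow> ltree" where
  "local_limit T = (if \<exists>t. converges_locally T t then THE t. converges_locally T t
                    else [[] \<mapsto> Active])"

text \<open>
  The tree built from the steps \<open>x 1, x 2, \<dots>\<close> in \<open>{-1, 1}\<close> and the chosen vertices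
  \<open>v 1, v 2, \<dots>\<close>. The choice \<open>v n\<close> is not used if no vertex is active at time \<open>n - 1\<close>.
\<close>

primrec uaf_tree :: "(nat \<Rightarrow> int) \<Rightarrow> (nat \<Rightarrow> nat list) \<Rightarrow> nat \<Rightarrow> ltree" where
  "uaf_tree x v 0 = [[] \<mapsto> Active]"
| "uaf_tree x v (Suc n) =
     (let t = uaf_tree x v n in
      if active t = {} then t
      else if x (Suc n) = -1 then t(v (Suc n) \<mapsto> Frozen (Suc n))
      else t(v (Suc n) @ [Suc n] \<mapsto> Active))"

text \<open>The sigma-algebra generated by the whole sequence \<open>X\<close> and the choices made before time
  \<open>n\<close>.\<close>

definition uaf_past ::
    "'a measure \<Rightarrow> (nat \<Rightarrow> 'a \<Rightarrow> int) \<Rightarrow> (nat \<Rightarrow> 'a \<Rightarrow> nat list) \<Rightarrow> nat \<Rightarrow> 'a measure" where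
  "uaf_past M X V n = sigma (space M)
     ({X i -` A \<inter> space M | i A. 1 \<le> i} \<union> {V i -` A \<inter> space M | i A. 1 \<le> i \<and> i < n})"

text \<open>
  Given \<open>X\<close> and the previous choices, \<open>V n\<close> is uniform on the active vertices at time \<open>n - 1\<close>,
  if there are any.
\<close>

definition uaf_choices ::
    "'a measure \<Rightarrow> (nat \<Rightarrow> 'a \<Rightarrow> int) \<Rightarrow> (nat \<Rightarrow> 'a \<Rightarrow> nat list) \<Rightarrow> bool" where
  "uaf_choices M X V \<longleftrightarrow>
     (\<forall>n\<ge>1. V n \<in> measurable M (count_space UNIV)) \<and>
     (\<forall>n\<ge>1. \<forall>u. AE \<omega> in M.
        let S = active (uaf_tree (\<lambda>i. X i \<omega>) (\<lambda>i. V i \<omega>) (n - 1)) in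
        S \<noteq> {} \<longrightarrow>
        real_cond_exp M (uaf_past M X V n) (indicator {\<omega>' \<in> space M. V n \<omega>' = u}) \<omega>
          = pmf (pmf_of_set S) u)"

definition plane_tree :: "nat list set \<Rightarrow> bool" where
  "plane_tree \<tau> \<longleftrightarrow> \<tau> \<subseteq> lists {1..} \<and> [] \<in> \<tau> \<and> (\<forall>u j. u @ [j] \<in> \<tau> \<longrightarrow> u \<in> \<tau>) \<and>
     (\<forall>u\<in>\<tau>. \<exists>k. \<forall>j\<ge>1. u @ [j] \<in> \<tau> \<longleftrightarrow> j \<le> k)"

definition num_children :: "nat list set \<Rightarrow> nat list \<Rightarrow> nat" where
  "num_children \<tau> u = (THE k. \<forall>j\<ge>1. u @ [j] \<in> \<tau> \<longleftrightarrow> j \<le> k)"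

definition subtree :: "nat list \<Rightarrow> nat list set \<Rightarrow> nat list set" where
  "subtree u \<tau> = {v. u @ v \<in> \<tau>}"

definition plane_trees :: "nat list set measure" where
  "plane_trees = sigma (Collect plane_tree) {{\<tau>. plane_tree \<tau> \<and> u \<in> \<tau>} | u. True}"

text \<open>
  The \<open>i\<close>-th letter of the image of \<open>u\<close> is the rank, among the labels of all edges going down
  from the ancestor of \<open>u\<close> at height \<open>i\<close>, of the label of the edge leading to \<open>u\<close>.
\<close>

definition rank_word :: "ltree \<Rightarrow> nat list \<Rightarrow> nat list" where
  "rank_word t u =
     map (\<lambda>i. card {m. take i u @ [m] \<in> dom t \<and> m \<le> u ! i}) [0..<length u]"

definition plane_of :: "ltree \<Rightarrow> nat list set" where
  "plane_of t = rank_word t ` dom t"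

text \<open>
  The conditional measure is restricted to the conditioning event because \<open>subtree [i] \<tau>\<close> is
  a plane tree only if the root of \<open>\<tau>\<close> has at least \<open>i\<close> children.
\<close>

definition cond_measure :: "'a measure \<Rightarrow> 'a set \<Rightarrow> 'a measure" where
  "cond_measure P A = restrict_space (uniform_measure P A) A"

definition bienayme_law :: "nat pmf \<Rightarrow> nat list set measure \<Rightarrow> bool" where
  "bienayme_law \<mu> P \<longleftrightarrow>
     prob_space P \<and> sets P = sets plane_trees \<and>
     (\<forall>j. measure P {\<tau> \<in> space P. num_children \<tau> [] = j} = pmf \<mu> j) \<and>
     (\<forall>j\<ge>1. pmf \<mu> j > 0 \<longrightarrow>
        (let Q = cond_measure P {\<tau> \<in> space P. num_children \<tau> [] = j} in
         prob_space.indep_vars Q (\<lambda>_. plane_trees) (\<lambda>i. subtree [i]) {1..j} \<and>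
         (\<forall>i\<in>{1..j}. distr Q plane_trees (subtree [i]) = P)))"

end

theory Submission
  imports Defs "HOL-Library.Sublist"
begin

text \<open>  The geometric law \<open>\<mu>(k) = (1 - p) p\<^sup>k\<close> is the number of successes before the first failure in
  independent trials of success probability \<open>p\<close>. Each vertex performs such trials: whenever it is
  chosen, it receives a child with probability \<open>p\<close> and is frozen with probability \<open>1 - p\<close>. Which
  vertex is chosen does not depend on the outcome of its next trial, so different vertices behave
  independently, whatever the order in which they are served. That the choice is uniform ensures that
  every active vertex is eventually frozen, so that no trial sequence is cut short.

  The law of a random plane tree is determined by the probabilities of the cylinders ``each word \<open>w\<close>
  of the finite set \<open>A\<close> is a vertex with \<open>k(w)\<close> children'', and a law that gives each of them
  the probability \<open>\<Prod>w\<in>A. \<mu>(k(w))\<close> has the branching property: fixing the number of children of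
  the root and a cylinder for each of its subtrees fixes a cylinder of the whole tree
  (\<open>cylinder_joint\<close>, \<open>bienayme_lawI\<close>).

  To compute the probability of a cylinder, attach to each stage of the construction the conditional
  probability that it should have according to the heuristic above (\<open>likelihood\<close>): the word \<open>w\<close>
  contributes \<open>\<mu>(k(w))\<close> if it is not yet born, \<open>\<mu>(k(w) - c)\<close> if it is active with \<open>c \<le> k(w)\<close>
  children, and otherwise \<open>0\<close> or \<open>1\<close>. This is a bounded martingale, because a new edge always
  carries the largest label, so that the plane word of a vertex is known at its birth and never changes
  (\<open>plane_of_attach\<close>, \<open>likelihood_mean\<close>). Its initial value is \<open>\<Prod>w\<in>A. \<mu>(k(w))\<close>. Once
  all vertices up to the relevant height are frozen it equals the indicator of the cylinder
  (\<open>eventually_likelihood\<close>), and dominated convergence gives the formula (\<open>prob_cylinder\<close>).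

  It remains to see that every vertex is eventually frozen. At step \<open>n + 1\<close> there are at most
  \<open>n + 1\<close> active vertices, so a given active vertex is frozen with conditional probability at least
  \<open>(1 - p) / (n + 1)\<close>, and the harmonic series diverges (\<open>prob_active_tendsto_0\<close>). By induction on
  the height, each ball around the root then stops changing, which is local convergence
  (\<open>stabilises_below_height\<close>).

  The probabilistic input is the law of the history up to time \<open>n\<close>, which is that of an explicit
  Markov chain (\<open>distr_history\<close>); all expectations are computed for that chain.\<close>

section \<open>Plane trees and the branching property\<close>

lemma num_children_eqI:
  assumes "\<And>j. j \<ge> 1 \<Longrightarrow> u @ [j] \<in> \<tau> \<longleftrightarrow> j \<le> k"
  shows "num_children \<tau> u = k"
  unfolding num_children_def
proof (rule the_equality)
  fix k' assume k': "\<forall>j\<ge>1. u @ [j] \<in> \<tau> \<longleftrightarrow> j \<le> k'"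
  have "j \<le> k' \<longleftrightarrow> j \<le> k" if "j \<ge> 1" for j
    using assms[OF that] k' that by blast
  from this[of k] this[of k'] this[of "Suc k"] this[of "Suc k'"] show "k' = k"
    by (cases k; cases k') auto
qed (use assms in blast)

lemma plane_tree_child_iff:
  assumes "plane_tree \<tau>" "u \<in> \<tau>"
  shows "u @ [j] \<in> \<tau> \<longleftrightarrow> 1 \<le> j \<and> j \<le> num_children \<tau> u"
proof -
  obtain k where k: "\<forall>j\<ge>1. u @ [j] \<in> \<tau> \<longleftrightarrow> j \<le> k"
    using assms unfolding plane_tree_def by blast
  have "num_children \<tau> u = k"
    by (rule num_children_eqI) (use k in auto)
  moreover have "1 \<le> j" if "u @ [j] \<in> \<tau>"
    using that assms(1) by (auto simp: plane_tree_def subset_iff)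
  ultimately show ?thesis using k by blast
qed

lemma plane_tree_prefix:
  assumes "plane_tree \<tau>" "u \<in> \<tau>" "prefix w u"
  shows "w \<in> \<tau>"
proof -
  have "w @ v \<in> \<tau> \<Longrightarrow> w \<in> \<tau>" for v
    by (induction v rule: rev_induct)
      (use assms(1) in \<open>auto simp: plane_tree_def simp flip: append_assoc\<close>)
  then show ?thesis using assms(2,3) by (auto simp: prefix_def)
qed

lemma subtree_plane_tree:
  assumes "plane_tree \<tau>" "u \<in> \<tau>"
  shows "plane_tree (subtree u \<tau>)"
  using assms unfolding plane_tree_def subtree_def
  by (auto simp: subset_iff simp flip: append_assoc)

lemma mem_subtree: "v \<in> subtree u \<tau> \<longleftrightarrow> u @ v \<in> \<tau>"
  by (simp add: subtree_def)

lemma num_children_subtree: "num_children (subtree u \<tau>) w = num_children \<tau> (u @ w)"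
  by (simp add: num_children_def subtree_def)

text \<open>The cylinders generate the sigma-algebra on plane trees. For a coherent pair \<open>(A, k)\<close> the set \<open>A\<close>
  is closed under taking prefixes and \<open>k\<close> allows every word of \<open>A\<close> to exist.
  The empty set is added to the generator to make it stable under intersections; \<open>A = {}\<close> gives the
  set of all plane trees.\<close>

definition cylinder :: "nat list set \<Rightarrow> (nat list \<Rightarrow> nat) \<Rightarrow> nat list set set" where
  "cylinder A k = {\<tau>. plane_tree \<tau> \<and> (\<forall>w\<in>A. w \<in> \<tau> \<and> num_children \<tau> w = k w)}"

definition coherent :: "nat list set \<Rightarrow> (nat list \<Rightarrow> nat) \<Rightarrow> bool" where
  "coherent A k \<longleftrightarrow> finite A \<and> (\<forall>w j. w @ [j] \<in> A \<longrightarrow> w \<in> A \<and> 1 \<le> j \<and> j \<le> k w)"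

definition cylinders :: "nat list set set set" where
  "cylinders = insert {} {cylinder A k | A k. coherent A k}"

lemma space_plane_trees [simp]: "space plane_trees = Collect plane_tree"
  by (simp add: plane_trees_def space_measure_of_conv)

lemma sets_plane_trees:
  "sets plane_trees = sigma_sets (Collect plane_tree) {{\<tau>. plane_tree \<tau> \<and> u \<in> \<tau>} | u. True}"
  unfolding plane_trees_def by (rule sets_measure_of) auto

lemma measurable_plane_treesI:
  assumes "\<And>\<omega>. \<omega> \<in> space N \<Longrightarrow> plane_tree (f \<omega>)"
    and "\<And>u. {\<omega> \<in> space N. u \<in> f \<omega>} \<in> sets N"
  shows "f \<in> measurable N plane_trees"
  unfolding plane_trees_def
proof (rule measurable_measure_of)
  show "f \<in> space N \<rightarrow> Collect plane_tree" using assms(1) by auto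
  fix B assume "B \<in> {{\<tau>. plane_tree \<tau> \<and> u \<in> \<tau>} | u. True}"
  then obtain u where B: "B = {\<tau>. plane_tree \<tau> \<and> u \<in> \<tau>}" by auto
  have "f -` B \<inter> space N = {\<omega> \<in> space N. u \<in> f \<omega>}"
    using assms(1) by (auto simp: B)
  then show "f -` B \<inter> space N \<in> sets N" using assms(2) by simp
qed auto

lemma sets_plane_trees_mem [measurable]: "{\<tau>. plane_tree \<tau> \<and> u \<in> \<tau>} \<in> sets plane_trees"
  unfolding sets_plane_trees by (rule sigma_sets.Basic) auto

lemma sets_plane_trees_num_children: "{\<tau>. plane_tree \<tau> \<and> u \<in> \<tau> \<and> num_children \<tau> u = k} \<in> sets plane_trees"
proof -
  have "{\<tau>. plane_tree \<tau> \<and> u \<in> \<tau> \<and> num_children \<tau> u = k} =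
    (if k = 0 then {\<tau>. plane_tree \<tau> \<and> u \<in> \<tau>} else {\<tau>. plane_tree \<tau> \<and> u @ [k] \<in> \<tau>})
      - {\<tau>. plane_tree \<tau> \<and> u @ [Suc k] \<in> \<tau>}"
    (is "?L = ?R")
  proof (intro set_eqI)
    fix \<tau>
    have "u \<in> \<tau>" if "plane_tree \<tau>" "u @ [k] \<in> \<tau>"
      using plane_tree_prefix[OF that, of u] by simp
    then show "\<tau> \<in> ?L \<longleftrightarrow> \<tau> \<in> ?R"
      using plane_tree_child_iff[of \<tau> u k] plane_tree_child_iff[of \<tau> u "Suc k"]
      by (cases "plane_tree \<tau>") auto
  qed
  then show ?thesis by simp
qed

lemma sets_cylinder:
  assumes "finite A"
  shows "cylinder A k \<in> sets plane_trees"
proof -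
  have "cylinder A k = Collect plane_tree \<inter>
      (\<Inter>w\<in>A. {\<tau>. plane_tree \<tau> \<and> w \<in> \<tau> \<and> num_children \<tau> w = k w})" if "A \<noteq> {}"
    using that by (auto simp: cylinder_def)
  moreover have "Collect plane_tree \<in> sets plane_trees"
    by (metis sets.top space_plane_trees)
  ultimately show ?thesis using assms
    by (cases "A = {}")
      (auto simp: cylinder_def[of "{}"] intro!: sets.Int sets.finite_INT sets_plane_trees_num_children)
qed

text \<open>If \<open>k\<close> and \<open>l\<close> agree on \<open>A \<inter> B\<close> they can be merged on \<open>A \<union> B\<close>; otherwise the
  two cylinders contradict each other.\<close>

lemma cylinder_Int:
  assumes "coherent A k" "coherent B l"
  shows "cylinder A k \<inter> cylinder B l \<in> cylinders"
proof (cases "\<forall>w\<in>A \<inter> B. k w = l w")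
  case True
  define m where "m w = (if w \<in> A then k w else l w)" for w
  have "coherent (A \<union> B) m"
    using assms True by (auto simp: coherent_def m_def)
  moreover have "cylinder A k \<inter> cylinder B l = cylinder (A \<union> B) m"
    using True by (auto simp: cylinder_def m_def)
  ultimately show ?thesis by (auto simp: cylinders_def)
next
  case False
  then have "cylinder A k \<inter> cylinder B l = {}" by (fastforce simp: cylinder_def)
  then show ?thesis by (simp add: cylinders_def)
qed

lemma Int_stable_cylinders: "Int_stable cylinders"
proof (rule Int_stableI)
  fix a b assume ab: "a \<in> cylinders" "b \<in> cylinders"
  show "a \<inter> b \<in> cylinders"
  proof (cases "a = {} \<or> b = {}")
    case True
    then show ?thesis by (auto simp: cylinders_def)
  next
    case False
    with ab obtain A k B l where "a = cylinder A k" "b = cylinder B l" "coherent A k" "coherent B l"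
      by (auto simp: cylinders_def)
    then show ?thesis using cylinder_Int by simp
  qed
qed

text \<open>A tree contains \<open>u\<close> iff the numbers of children along the path to \<open>u\<close> are large enough. A
  list \<open>ks\<close> records these numbers, one per height, so that the union is countable.\<close>

lemma mem_eq_Union_cylinders:
  defines "k \<equiv> \<lambda>ks w. (ks :: nat list) ! length w"
  shows "{\<tau>. plane_tree \<tau> \<and> u \<in> \<tau>} =
    (\<Union>ks\<in>{ks. coherent (set (prefixes u)) (k ks)}. cylinder (set (prefixes u)) (k ks))"
proof (intro equalityI subsetI)
  fix \<tau> assume "\<tau> \<in> {\<tau>. plane_tree \<tau> \<and> u \<in> \<tau>}"
  then have \<tau>: "plane_tree \<tau>" "u \<in> \<tau>" by auto
  define ks where "ks = map (\<lambda>i. num_children \<tau> (take i u)) [0..<Suc (length u)]"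
  have ks: "k ks w = num_children \<tau> w" if "prefix w u" for w
  proof -
    have "length w < Suc (length u)" "take (length w) u = w"
      using that by (auto simp: prefix_length_le less_Suc_eq_le prefix_def)
    then show ?thesis by (simp add: k_def ks_def del: upt_Suc)
  qed
  have pre: "w \<in> \<tau>" if "prefix w u" for w
    using plane_tree_prefix[OF \<tau>] that by blast
  have "coherent (set (prefixes u)) (k ks)"
    unfolding coherent_def
  proof (intro conjI allI impI)
    fix w j assume w: "w @ [j] \<in> set (prefixes u)"
    then have p: "prefix w u" by (auto dest: append_prefixD)
    then show "w \<in> set (prefixes u)" by simp
    have "w @ [j] \<in> \<tau>" using pre w by simp
    then show "1 \<le> j" "j \<le> k ks w"
      using plane_tree_child_iff[OF \<tau>(1) pre[OF p]] ks[OF p] by auto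
  qed simp
  moreover have "\<tau> \<in> cylinder (set (prefixes u)) (k ks)"
    using \<tau> ks pre by (auto simp: cylinder_def)
  ultimately show "\<tau> \<in> (\<Union>ks\<in>{ks. coherent (set (prefixes u)) (k ks)}. cylinder (set (prefixes u)) (k ks))"
    by blast
qed (auto simp: cylinder_def)

lemma sets_plane_trees_cylinders:
  "sets plane_trees = sigma_sets (Collect plane_tree) cylinders"
proof
  interpret C: sigma_algebra "Collect plane_tree" "sigma_sets (Collect plane_tree) cylinders"
    by (rule sigma_algebra_sigma_sets) (auto simp: cylinders_def cylinder_def)
  show "sets plane_trees \<subseteq> sigma_sets (Collect plane_tree) cylinders"
    unfolding sets_plane_trees
  proof (rule C.sigma_sets_subset, safe)
    fix u
    show "{\<tau>. plane_tree \<tau> \<and> u \<in> \<tau>} \<in> sigma_sets (Collect plane_tree) cylinders"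
      unfolding mem_eq_Union_cylinders
      by (intro C.countable_UN'' sigma_sets.Basic) (auto simp: cylinders_def)
  qed
  show "sigma_sets (Collect plane_tree) cylinders \<subseteq> sets plane_trees"
    using sets.sigma_sets_subset[of cylinders plane_trees]
    by (auto simp: cylinders_def coherent_def intro: sets_cylinder)
qed

lemma plane_tree_measure_eqI:
  assumes P: "sets P = sets plane_trees" and Q: "sets Q = sets plane_trees"
    and "prob_space P"
    and eq: "\<And>A k. coherent A k \<Longrightarrow> emeasure P (cylinder A k) = emeasure Q (cylinder A k)"
  shows "P = Q"
proof (rule measure_eqI_generator_eq)
  interpret P: prob_space P by fact
  show "Int_stable cylinders" by (rule Int_stable_cylinders)
  show "cylinders \<subseteq> Pow (Collect plane_tree)" by (auto simp: cylinders_def cylinder_def)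
  show "sets P = sigma_sets (Collect plane_tree) cylinders"
    "sets Q = sigma_sets (Collect plane_tree) cylinders"
    by (simp_all add: P Q sets_plane_trees_cylinders)
  show "emeasure P C = emeasure Q C" if "C \<in> cylinders" for C
    using that eq by (auto simp: cylinders_def)
  show "range (\<lambda>_::nat. cylinder {} (\<lambda>_. 0)) \<subseteq> cylinders"
    by (auto simp: cylinders_def coherent_def)
  show "(\<Union>i::nat. cylinder {} (\<lambda>_. 0)) = Collect plane_tree" by (auto simp: cylinder_def)
qed (use assms(3) in \<open>simp add: prob_space.emeasure_space_1 finite_measure.emeasure_finite prob_space.finite_measure\<close>)

text \<open>The reason for the branching property: \<open>n\<close> children at the root together with a cylinder for
  some of the subtrees is again a cylinder, and the product over its words splits accordingly.\<close>

lemma cylinder_joint: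
  assumes J: "finite J" "J \<subseteq> {1..n}"
    and coh: "\<And>i. i \<in> J \<Longrightarrow> coherent (A i) (k i)"
  defines "B \<equiv> insert [] (\<Union>i\<in>J. (#) i ` A i)"
    and "l \<equiv> \<lambda>w. case w of [] \<Rightarrow> n | i # v \<Rightarrow> k i v"
  shows "coherent B l"
    and "cylinder B l = {\<tau>. plane_tree \<tau> \<and> num_children \<tau> [] = n \<and>
      (\<forall>i\<in>J. subtree [i] \<tau> \<in> cylinder (A i) (k i))}"
    and "(\<Prod>w\<in>B. g (l w)) = g n * (\<Prod>i\<in>J. \<Prod>w\<in>A i. g (k i w))"
proof -
  show "coherent B l"
    unfolding coherent_def
  proof (intro conjI allI impI)
    show "finite B" using J(1) coh by (auto simp: B_def coherent_def)
    fix w j assume w: "w @ [j] \<in> B"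
    then obtain i v where i: "i \<in> J" "v \<in> A i" "w @ [j] = i # v"
      by (auto simp: B_def)
    have "w \<in> B \<and> 1 \<le> j \<and> j \<le> l w"
    proof (cases w)
      case Nil
      then show ?thesis using i J(2) by (auto simp: B_def l_def)
    next
      case (Cons a w')
      then have "a = i" "w' @ [j] \<in> A i" using i by auto
      then have "w' \<in> A i \<and> 1 \<le> j \<and> j \<le> k i w'"
        using coh[OF i(1)] by (simp add: coherent_def)
      then show ?thesis using Cons i(1) \<open>a = i\<close> by (auto simp: B_def l_def)
    qed
    then show "w \<in> B" "1 \<le> j" "j \<le> l w" by simp_all
  qed
  show "cylinder B l = {\<tau>. plane_tree \<tau> \<and> num_children \<tau> [] = n \<and>
      (\<forall>i\<in>J. subtree [i] \<tau> \<in> cylinder (A i) (k i))}" (is "_ = ?R")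
  proof (intro set_eqI)
    fix \<tau>
    show "\<tau> \<in> cylinder B l \<longleftrightarrow> \<tau> \<in> ?R"
    proof (cases "plane_tree \<tau> \<and> num_children \<tau> [] = n")
      case True
      then have root: "[] \<in> \<tau>" by (simp add: plane_tree_def)
      have "plane_tree (subtree [i] \<tau>)" if "i \<in> J" for i
      proof (rule subtree_plane_tree)
        show "[i] \<in> \<tau>"
          using plane_tree_child_iff[OF _ root, of i] True J(2) that by auto
      qed (use True in simp)
      then show ?thesis
        using True root
        by (auto simp: cylinder_def B_def l_def num_children_subtree mem_subtree)
    next
      case False
      then show ?thesis by (auto simp: cylinder_def B_def l_def)
    qed
  qed
  have "(\<Prod>w\<in>(\<Union>i\<in>J. (#) i ` A i). g (l w)) = (\<Prod>i\<in>J. \<Prod>w\<in>(#) i ` A i. g (l w))"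
    using J(1) coh by (intro prod.UNION_disjoint) (auto simp: coherent_def)
  also have "\<dots> = (\<Prod>i\<in>J. \<Prod>w\<in>A i. g (k i w))"
    by (rule prod.cong[OF refl]) (simp add: prod.reindex l_def)
  finally show "(\<Prod>w\<in>B. g (l w)) = g n * (\<Prod>i\<in>J. \<Prod>w\<in>A i. g (k i w))"
    unfolding B_def using J(1) coh
    by (subst prod.insert) (auto simp: l_def coherent_def)
qed

text \<open>By \<open>cylinder_joint\<close>, conditionally on the degree of the root, the probability that the subtrees
  lie in given cylinders is the product of the probabilities that \<open>P\<close> gives to these cylinders. The
  cylinders are a generator stable under intersections, so this yields both the independence of the
  subtrees and their law.\<close>

lemma bienayme_lawI:
  assumes "prob_space P" and sets_P: "sets P = sets plane_trees"
    and cyl: "\<And>A k. coherent A k \<Longrightarrow> measure P (cylinder A k) = (\<Prod>w\<in>A. pmf \<mu> (k w))"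
  shows "bienayme_law \<mu> P"
proof -
  interpret P: prob_space P by fact
  have space_P: "space P = Collect plane_tree"
    using sets_eq_imp_space_eq[OF sets_P] by simp
  have root: "{\<tau> \<in> space P. num_children \<tau> [] = j} = cylinder {[]} (\<lambda>_. j)" for j
    by (auto simp: space_P cylinder_def plane_tree_def)
  have coh_root: "coherent {[]} (\<lambda>_. j)" for j by (auto simp: coherent_def)
  have branching: "prob_space.indep_vars Q (\<lambda>_. plane_trees) (\<lambda>i. subtree [i]) {1..n} \<and>
      (\<forall>i\<in>{1..n}. distr Q plane_trees (subtree [i]) = P)"
    if pos: "pmf \<mu> n > 0" and Q: "Q = cond_measure P {\<tau> \<in> space P. num_children \<tau> [] = n}"
    for n Q
  proof -
    define E where "E = {\<tau> \<in> space P. num_children \<tau> [] = n}"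
    have E: "E \<in> sets P" unfolding E_def root sets_P by (rule sets_cylinder) simp
    have PE: "measure P E = pmf \<mu> n" using cyl[OF coh_root, of n] by (simp add: E_def root)
    then have PE0: "emeasure P E \<noteq> 0" "emeasure P E \<noteq> \<infinity>"
      using pos by (simp_all add: P.emeasure_eq_measure)
    have Q_restr: "Q = restrict_space (uniform_measure P E) E"
      by (simp add: Q cond_measure_def E_def)
    have space_Q: "space Q = E"
      using sets.sets_into_space[OF E] by (auto simp: Q_restr space_restrict_space)
    interpret Q: prob_space Q
      unfolding Q_restr
      by (rule prob_space_restrict_space) (use E emeasure_uniform_measure_1[OF PE0] in simp_all)
    have measure_Q: "measure Q B = measure P B / pmf \<mu> n" if "B \<in> sets P" "B \<subseteq> E" for B
    proof -
      have "measure Q B = measure (uniform_measure P E) B"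
        unfolding Q_restr by (rule measure_restrict_space) (use E that in auto)
      also have "\<dots> = measure P (E \<inter> B) / pmf \<mu> n"
        using PE0 that by (simp add: PE)
      also have "E \<inter> B = B" using that by auto
      finally show ?thesis .
    qed
    have sets_Q: "B \<in> sets Q" if "B \<in> sets P" "B \<subseteq> E" for B
      using that E by (auto simp: Q_restr sets_restrict_space)
    have child: "plane_tree (subtree [i] \<tau>)" if "i \<in> {1..n}" "\<tau> \<in> E" for i \<tau>
    proof (rule subtree_plane_tree)
      show "plane_tree \<tau>" using that by (simp add: E_def space_P)
      then show "[i] \<in> \<tau>"
        using plane_tree_child_iff[of \<tau> "[]" i] that by (auto simp: E_def plane_tree_def)
    qed
    have meas: "subtree [i] \<in> measurable Q plane_trees" if "i \<in> {1..n}" for i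
    proof (rule measurable_plane_treesI)
      show "plane_tree (subtree [i] \<tau>)" if "\<tau> \<in> space Q" for \<tau>
        using child \<open>i \<in> {1..n}\<close> that by (simp add: space_Q)
      fix u
      have "{\<tau> \<in> space Q. u \<in> subtree [i] \<tau>} = {\<tau>. plane_tree \<tau> \<and> i # u \<in> \<tau>} \<inter> E"
        by (auto simp: space_Q subtree_def E_def space_P)
      also have "\<dots> \<in> sets Q"
        by (rule sets_Q) (use E sets_plane_trees_mem in \<open>auto simp: sets_P\<close>)
      finally show "{\<tau> \<in> space Q. u \<in> subtree [i] \<tau>} \<in> sets Q" .
    qed
    have joint: "measure Q {\<tau> \<in> space Q. \<forall>i\<in>J. subtree [i] \<tau> \<in> cylinder (A i) (k i)} =
        (\<Prod>i\<in>J. \<Prod>w\<in>A i. pmf \<mu> (k i w))"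
      if J: "finite J" "J \<subseteq> {1..n}" and coh: "\<And>i. i \<in> J \<Longrightarrow> coherent (A i) (k i)"
      for J A k
    proof -
      define B where "B = insert [] (\<Union>i\<in>J. (#) i ` A i)"
      define l where "l w = (case w of [] \<Rightarrow> n | i # v \<Rightarrow> k i v)" for w
      note cj = cylinder_joint[of J n A k, OF J coh, folded B_def l_def[abs_def]]
      have eq: "{\<tau> \<in> space Q. \<forall>i\<in>J. subtree [i] \<tau> \<in> cylinder (A i) (k i)} = cylinder B l"
        using cj(2) by (auto simp: space_Q E_def space_P)
      have "measure Q (cylinder B l) = measure P (cylinder B l) / pmf \<mu> n"
      proof (rule measure_Q)
        show "cylinder B l \<in> sets P"
          unfolding sets_P by (rule sets_cylinder) (use cj(1) in \<open>simp add: coherent_def\<close>)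
        show "cylinder B l \<subseteq> E" unfolding eq[symmetric] by (auto simp: space_Q)
      qed
      then show ?thesis
        using cyl[OF cj(1)] cj(3)[of "pmf \<mu>"] pos by (simp add: eq)
    qed
    have single: "measure Q (subtree [i] -` cylinder A k \<inter> space Q) = (\<Prod>w\<in>A. pmf \<mu> (k w))"
      if "i \<in> {1..n}" "coherent A k" for i A k
      using joint[of "{i}" "\<lambda>_. A" "\<lambda>_. k"] that by (simp add: vimage_def Int_def conj_commute)
    have law: "distr Q plane_trees (subtree [i]) = P" if "i \<in> {1..n}" for i
    proof (rule plane_tree_measure_eqI)
      show "prob_space (distr Q plane_trees (subtree [i]))"
        by (rule Q.prob_space_distr) (rule meas[OF that])
      fix A k assume coh: "coherent A k"
      have "emeasure (distr Q plane_trees (subtree [i])) (cylinder A k) =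
          emeasure Q (subtree [i] -` cylinder A k \<inter> space Q)"
        by (rule emeasure_distr[OF meas[OF that]]) (use coh in \<open>auto simp: coherent_def intro: sets_cylinder\<close>)
      also have "\<dots> = emeasure P (cylinder A k)"
        using single[OF that coh] cyl[OF coh] by (simp add: Q.emeasure_eq_measure P.emeasure_eq_measure)
      finally show "emeasure (distr Q plane_trees (subtree [i])) (cylinder A k) = emeasure P (cylinder A k)" .
    qed (simp_all add: sets_P)
    \<comment> \<open>independence is checked on preimages of cylinders, which are stable under intersections\<close>
    define F where "F i = {subtree [i] -` C \<inter> space Q | C. C \<in> cylinders}" for i
    have "Q.indep_sets F {1..n}"
    proof (rule Q.indep_setsI)
      fix i assume i: "i \<in> {1..n}"
      show "F i \<subseteq> Q.events"
        unfolding F_def using measurable_sets[OF meas[OF i]]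
        by (auto simp: cylinders_def coherent_def intro: sets_cylinder)
    next
      fix B J assume J: "J \<noteq> {}" "J \<subseteq> {1..n}" "finite J" "\<forall>j\<in>J. B j \<in> F j"
      have "\<forall>i\<in>J. \<exists>C. C \<in> cylinders \<and> B i = subtree [i] -` C \<inter> space Q"
        using J(4) by (auto simp: F_def)
      then obtain C where C: "\<And>i. i \<in> J \<Longrightarrow> C i \<in> cylinders"
        "\<And>i. i \<in> J \<Longrightarrow> B i = subtree [i] -` C i \<inter> space Q"
        by metis
      show "Q.prob (\<Inter>j\<in>J. B j) = (\<Prod>j\<in>J. Q.prob (B j))"
      proof (cases "\<exists>i\<in>J. C i = {}")
        case True
        then obtain i where i: "i \<in> J" "B i = {}" using C by auto
        then have "(\<Inter>j\<in>J. B j) = {}" by auto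
        moreover have "(\<Prod>j\<in>J. Q.prob (B j)) = 0"
          by (rule prod_zero[OF J(3)]) (use i in \<open>intro bexI[of _ i]; simp\<close>)
        ultimately show ?thesis by simp
      next
        case False
        then have "\<forall>i\<in>J. \<exists>A k. coherent A k \<and> C i = cylinder A k"
          using C(1) unfolding cylinders_def by blast
        then obtain A k where Ak: "\<And>i. i \<in> J \<Longrightarrow> coherent (A i) (k i)"
          "\<And>i. i \<in> J \<Longrightarrow> C i = cylinder (A i) (k i)"
          by metis
        have "(\<Inter>j\<in>J. B j) = {\<tau> \<in> space Q. \<forall>i\<in>J. subtree [i] \<tau> \<in> cylinder (A i) (k i)}"
          using J(1) C(2) Ak(2) by auto
        then have "Q.prob (\<Inter>j\<in>J. B j) = (\<Prod>i\<in>J. \<Prod>w\<in>A i. pmf \<mu> (k i w))"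
          using joint[OF J(3,2) Ak(1)] by simp
        also have "\<dots> = (\<Prod>j\<in>J. Q.prob (B j))"
          using J(2) Ak C(2) single by (intro prod.cong) auto
        finally show ?thesis .
      qed
    qed
    then have indep: "Q.indep_sets (\<lambda>i. sigma_sets (space Q) (F i)) {1..n}"
    proof (rule Q.indep_sets_sigma)
      show "Int_stable (F i)" if "i \<in> {1..n}" for i
      proof (rule Int_stableI)
        fix a b assume "a \<in> F i" "b \<in> F i"
        then obtain C D where "a = subtree [i] -` C \<inter> space Q" "b = subtree [i] -` D \<inter> space Q"
          "C \<in> cylinders" "D \<in> cylinders"
          by (auto simp: F_def)
        moreover from this have "C \<inter> D \<in> cylinders"
          using Int_stable_cylinders by (auto simp: Int_stable_def)
        ultimately show "a \<inter> b \<in> F i"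
          unfolding F_def by (intro CollectI exI[of _ "C \<inter> D"]) auto
      qed
    qed
    have gen: "sigma_sets (space Q) (F i) =
        {subtree [i] -` C \<inter> space Q | C. C \<in> sets plane_trees}" if "i \<in> {1..n}" for i
      unfolding F_def sets_plane_trees_cylinders
      by (rule sigma_sets_vimage_commute[symmetric]) (use child[OF that] in \<open>auto simp: space_Q\<close>)
    have "Q.indep_sets (\<lambda>i. {subtree [i] -` C \<inter> space Q | C. C \<in> sets plane_trees}) {1..n}"
      using indep gen Q.indep_sets_cong[of "{1..n}" "{1..n}" "\<lambda>i. sigma_sets (space Q) (F i)"
        "\<lambda>i. {subtree [i] -` C \<inter> space Q | C. C \<in> sets plane_trees}"] by blast
    then show ?thesis
      using meas law by (simp add: Q.indep_vars_def2)
  qed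
  show ?thesis
    unfolding bienayme_law_def Let_def
    using branching sets_P \<open>prob_space P\<close> cyl[OF coh_root] by (auto simp: root)
qed

section \<open>From edge labels to plane trees\<close>

definition child_labels :: "ltree \<Rightarrow> nat list \<Rightarrow> nat set" where
  "child_labels t u = {m. u @ [m] \<in> dom t}"

lemma rank_word_Nil [simp]: "rank_word t [] = []"
  by (simp add: rank_word_def)

lemma rank_word_snoc:
  "rank_word t (u @ [m]) = rank_word t u @ [card {m' \<in> child_labels t u. m' \<le> m}]"
  by (simp add: rank_word_def child_labels_def nth_append cong: map_cong)

lemma length_rank_word [simp]: "length (rank_word t u) = length u"
  by (simp add: rank_word_def)

lemma lf_tree_parent: "lf_tree t \<Longrightarrow> u @ [m] \<in> dom t \<Longrightarrow> u \<in> dom t"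
  by (auto simp: lf_tree_def)

text \<open>The ranks of the elements of a finite set of size \<open>c\<close> are exactly \<open>1, \<dots>, c\<close>. This turns
  the edge labels below a vertex into the letters of a plane tree.\<close>

lemma rank_bij:
  fixes C :: "nat set"
  assumes "finite C"
  shows "bij_betw (\<lambda>m. card {m' \<in> C. m' \<le> m}) C {1..card C}"
proof -
  let ?r = "\<lambda>m. card {m' \<in> C. m' \<le> m}"
  have less: "?r m < ?r m'" if "m < m'" "m' \<in> C" for m m'
  proof (rule psubset_card_mono)
    have "m' \<in> {l \<in> C. l \<le> m'} - {l \<in> C. l \<le> m}" using that by simp
    moreover have "{l \<in> C. l \<le> m} \<subseteq> {l \<in> C. l \<le> m'}" using that(1) by auto
    ultimately show "{l \<in> C. l \<le> m} \<subset> {l \<in> C. l \<le> m'}" by blast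
  qed (use assms in simp)
  have inj: "inj_on ?r C"
    by (rule inj_onI) (metis less less_irrefl nat_neq_iff)
  have sub: "?r ` C \<subseteq> {1..card C}"
  proof safe
    fix m assume "m \<in> C"
    then have "{m' \<in> C. m' \<le> m} \<noteq> {}" by blast
    then have "0 < ?r m" using assms by (simp add: card_gt_0_iff)
    moreover have "?r m \<le> card C" by (rule card_mono) (use assms in auto)
    ultimately show "?r m \<in> {1..card C}" unfolding atLeastAtMost_iff by linarith
  qed
  have "?r ` C = {1..card C}"
    by (rule card_subset_eq) (use sub card_image[OF inj] in auto)
  with inj show ?thesis by (simp add: bij_betw_def)
qed

text \<open>By induction on the height: equal ranks below the same parent force equal edge labels.\<close>

lemma rank_word_inj:
  assumes "lf_tree t"
  shows "inj_on (rank_word t) (dom t)"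
proof -
  have "u = v" if "u \<in> dom t" "v \<in> dom t" "rank_word t u = rank_word t v" for u v
    using that
  proof (induction u arbitrary: v rule: rev_induct)
    case Nil
    then show ?case by (metis length_0_conv length_rank_word list.size(3))
  next
    case (snoc m u)
    have "length v = Suc (length u)"
      using snoc.prems(3) by (metis length_append_singleton length_rank_word)
    then obtain v' m' where v: "v = v' @ [m']" by (metis length_Suc_conv_rev)
    have eq: "rank_word t u = rank_word t v'"
      "card {l \<in> child_labels t u. l \<le> m} = card {l \<in> child_labels t v'. l \<le> m'}"
      using snoc.prems(3) by (simp_all add: v rank_word_snoc)
    have "u = v'"
      using snoc.IH[OF _ _ eq(1)] lf_tree_parent[OF assms] snoc.prems(1,2) unfolding v by blast
    moreover have "finite (child_labels t u)"
      using assms by (simp add: lf_tree_def child_labels_def)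
    then have "inj_on (\<lambda>m. card {m' \<in> child_labels t u. m' \<le> m}) (child_labels t u)"
      using rank_bij bij_betw_imp_inj_on by blast
    ultimately have "m = m'"
      using eq(2) snoc.prems(1,2) unfolding v by (auto simp: inj_on_def child_labels_def)
    then show ?case using \<open>u = v'\<close> by (simp add: v)
  qed
  then show ?thesis by (auto intro: inj_onI)
qed

lemma plane_of_child_iff:
  assumes t: "lf_tree t" and u: "u \<in> dom t"
  shows "rank_word t u @ [j] \<in> plane_of t \<longleftrightarrow> 1 \<le> j \<and> j \<le> card (child_labels t u)"
proof -
  let ?r = "\<lambda>m. card {m' \<in> child_labels t u. m' \<le> m}"
  have bij: "bij_betw ?r (child_labels t u) {1..card (child_labels t u)}"
    using t by (intro rank_bij) (simp add: lf_tree_def child_labels_def)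
  have "rank_word t u @ [j] \<in> plane_of t \<longleftrightarrow> (\<exists>m\<in>child_labels t u. j = ?r m)"
  proof
    assume "rank_word t u @ [j] \<in> plane_of t"
    then obtain v where v: "v \<in> dom t" "rank_word t v = rank_word t u @ [j]"
      unfolding plane_of_def by (metis imageE)
    then have "length v = Suc (length u)" by (metis length_append_singleton length_rank_word)
    then obtain v' m where v': "v = v' @ [m]" by (metis length_Suc_conv_rev)
    have "v' = u"
      using rank_word_inj[OF t] v u lf_tree_parent[OF t, of v' m]
      by (auto simp: v' rank_word_snoc inj_on_def)
    then show "\<exists>m\<in>child_labels t u. j = ?r m"
      using v by (intro bexI[of _ m]) (auto simp: v' rank_word_snoc child_labels_def)
  next
    assume "\<exists>m\<in>child_labels t u. j = ?r m"
    then show "rank_word t u @ [j] \<in> plane_of t"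
      by (auto simp: plane_of_def child_labels_def rank_word_snoc intro!: image_eqI[of _ _ "u @ [_]"])
  qed
  also have "\<dots> \<longleftrightarrow> j \<in> {1..card (child_labels t u)}"
    using bij_betw_imp_surj_on[OF bij] by blast
  finally show ?thesis by simp
qed

lemma num_children_plane_of:
  assumes "lf_tree t" "u \<in> dom t"
  shows "num_children (plane_of t) (rank_word t u) = card (child_labels t u)"
  by (rule num_children_eqI) (simp add: plane_of_child_iff[OF assms])

lemma plane_tree_plane_of:
  assumes t: "lf_tree t"
  shows "plane_tree (plane_of t)"
  unfolding plane_tree_def
proof (intro conjI ballI allI impI)
  have "rank_word t u \<in> lists {1..}" if "u \<in> dom t" for u
    using that
  proof (induction u rule: rev_induct)
    case (snoc m u)
    have "u \<in> dom t" by (rule lf_tree_parent[OF t snoc.prems])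
    then have "rank_word t (u @ [m]) \<in> plane_of t \<longleftrightarrow>
        1 \<le> card {m' \<in> child_labels t u. m' \<le> m} \<and> card {m' \<in> child_labels t u. m' \<le> m} \<le> card (child_labels t u)"
      unfolding rank_word_snoc by (rule plane_of_child_iff[OF t])
    then have "1 \<le> card {m' \<in> child_labels t u. m' \<le> m}"
      using snoc.prems by (auto simp: plane_of_def)
    then show ?case using snoc.IH[OF \<open>u \<in> dom t\<close>] by (simp add: rank_word_snoc)
  qed simp
  then show "plane_of t \<subseteq> lists {1..}" by (auto simp: plane_of_def)
  show "[] \<in> plane_of t"
    using t unfolding plane_of_def lf_tree_def by (metis image_eqI rank_word_Nil)
  fix w
  show "w \<in> plane_of t" if w: "w @ [j] \<in> plane_of t" for j
  proof -
    obtain v where v: "v \<in> dom t" "rank_word t v = w @ [j]"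
      using w unfolding plane_of_def by (metis imageE)
    then have "length v = Suc (length w)" by (metis length_append_singleton length_rank_word)
    then obtain u m where u: "v = u @ [m]" by (metis length_Suc_conv_rev)
    have "u \<in> dom t" by (rule lf_tree_parent[OF t]) (use v u in simp)
    moreover have "rank_word t u = w" using v by (simp add: u rank_word_snoc)
    ultimately show ?thesis by (auto simp: plane_of_def)
  qed
  show "\<exists>k. \<forall>j\<ge>1. w @ [j] \<in> plane_of t \<longleftrightarrow> j \<le> k" if "w \<in> plane_of t"
    using that plane_of_child_iff[OF t] by (fastforce simp: plane_of_def)
qed

text \<open>Invariants of the tree at time \<open>n\<close>. The bound on the edge labels places the next new vertex to the
  right of its siblings; the bound on the number of active vertices bounds from below the probability
  that a given one is frozen.\<close>

definition labelled_tree :: "nat \<Rightarrow> ltree \<Rightarrow> bool" where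
  "labelled_tree n t \<longleftrightarrow> [] \<in> dom t \<and> (\<forall>u m. u @ [m] \<in> dom t \<longrightarrow> u \<in> dom t \<and> m \<le> n) \<and>
     finite (dom t) \<and> card (active t) \<le> Suc n"

lemma active_subset_dom: "active t \<subseteq> dom t"
  by (auto simp: active_def)

lemma labelled_tree_lf_tree:
  assumes "labelled_tree n t"
  shows "lf_tree t"
proof -
  have "finite {m. u @ [m] \<in> dom t}" for u
    by (rule finite_subset[of _ "{..n}"]) (use assms in \<open>auto simp: labelled_tree_def\<close>)
  then show ?thesis using assms by (simp add: labelled_tree_def lf_tree_def)
qed

lemma rank_word_cong:
  "dom t = dom t' \<Longrightarrow> rank_word t u = rank_word t' u"
  by (simp add: rank_word_def)

lemma labelled_tree_root: "labelled_tree 0 [[] \<mapsto> Active]"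
  by (auto simp: labelled_tree_def active_def)

lemma active_freeze: "active (t(v \<mapsto> Frozen n)) = active t - {v}"
  by (auto simp: active_def)

lemma active_attach: "active (t(v \<mapsto> Active)) = insert v (active t)"
  by (auto simp: active_def)

lemma labelled_tree_freeze:
  assumes "labelled_tree n t" "v \<in> active t"
  shows "labelled_tree (Suc n) (t(v \<mapsto> Frozen l))"
proof -
  have "dom (t(v \<mapsto> Frozen l)) = dom t" using assms(2) by (auto simp: active_def)
  moreover have "card (active t - {v}) \<le> card (active t)"
    by (rule card_Diff1_le)
  ultimately show ?thesis
    using assms(1) unfolding labelled_tree_def active_freeze by force
qed

lemma labelled_tree_attach:
  assumes "labelled_tree n t" "v \<in> active t"
  shows "labelled_tree (Suc n) (t(v @ [Suc n] \<mapsto> Active))"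
proof -
  have "dom (t(v @ [Suc n] \<mapsto> Active)) = insert (v @ [Suc n]) (dom t)" by auto
  moreover have "card (insert (v @ [Suc n]) (active t)) \<le> Suc (card (active t))"
    by (rule card_insert_le_m1) simp_all
  moreover have "v \<in> dom t" using assms(2) active_subset_dom by blast
  ultimately show ?thesis
    using assms(1) unfolding labelled_tree_def active_attach by force
qed

lemma plane_of_freeze:
  assumes t: "labelled_tree n t" and v: "v \<in> active t"
  shows "plane_of (t(v \<mapsto> Frozen l)) = plane_of t"
    and "rank_word (t(v \<mapsto> Frozen l)) ` active (t(v \<mapsto> Frozen l)) =
      rank_word t ` active t - {rank_word t v}"
proof -
  have dom: "dom (t(v \<mapsto> Frozen l)) = dom t" using v by (auto simp: active_def)
  have rank: "rank_word (t(v \<mapsto> Frozen l)) u = rank_word t u" for u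
    by (rule rank_word_cong[OF dom])
  show "plane_of (t(v \<mapsto> Frozen l)) = plane_of t"
    unfolding plane_of_def dom by (rule image_cong[OF refl rank])
  have "inj_on (rank_word t) (active t)"
    by (rule inj_on_subset[OF rank_word_inj[OF labelled_tree_lf_tree[OF t]] active_subset_dom])
  then have "rank_word t ` (active t - {v}) = rank_word t ` active t - rank_word t ` {v}"
    by (rule inj_on_image_set_diff) (use v in auto)
  moreover have "rank_word (t(v \<mapsto> Frozen l)) ` active (t(v \<mapsto> Frozen l)) =
      rank_word t ` (active t - {v})"
    unfolding active_freeze by (rule image_cong[OF refl rank])
  ultimately show "rank_word (t(v \<mapsto> Frozen l)) ` active (t(v \<mapsto> Frozen l)) =
      rank_word t ` active t - {rank_word t v}" by simp
qed

text \<open>The new edge has a label larger than all previous ones, so the new vertex becomes the last child of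
  \<open>v\<close> and the plane words of the older vertices do not change.\<close>

lemma plane_of_attach:
  fixes v n
  defines "u \<equiv> v @ [Suc n]"
  assumes t: "labelled_tree n t" and v: "v \<in> active t"
  defines "w \<equiv> rank_word t v"
  defines "w' \<equiv> w @ [Suc (num_children (plane_of t) w)]"
  shows "plane_of (t(u \<mapsto> Active)) = insert w' (plane_of t)"
    and "rank_word (t(u \<mapsto> Active)) ` active (t(u \<mapsto> Active)) = insert w' (rank_word t ` active t)"
proof -
  let ?t = "t(u \<mapsto> Active)"
  have dom: "dom ?t = insert u (dom t)" by auto
  have v_dom: "v \<in> dom t" using v active_subset_dom by blast
  have small: "child_labels t x \<subseteq> {..n}" for x
    using t by (auto simp: child_labels_def labelled_tree_def)
  have rank: "rank_word ?t x = rank_word t x" if "x \<in> dom t" for x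
    using that
  proof (induction x rule: rev_induct)
    case (snoc m x)
    then have "x \<in> dom t" "m \<le> n" using t unfolding labelled_tree_def by blast+
    then have "{m' \<in> child_labels ?t x. m' \<le> m} = {m' \<in> child_labels t x. m' \<le> m}"
      by (auto simp: child_labels_def u_def)
    then show ?case using snoc.IH[OF \<open>x \<in> dom t\<close>] by (simp only: rank_word_snoc)
  qed simp
  have "{m' \<in> child_labels ?t v. m' \<le> Suc n} = insert (Suc n) (child_labels t v)"
    using small[of v] by (auto simp: child_labels_def u_def)
  moreover have "Suc n \<notin> child_labels t v" using small[of v] by auto
  moreover have "finite (child_labels t v)" using small[of v] finite_subset by blast
  ultimately have new: "rank_word ?t u = w'"
    using rank[OF v_dom] num_children_plane_of[OF labelled_tree_lf_tree[OF t] v_dom]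
    by (simp add: u_def rank_word_snoc w'_def w_def)
  have "rank_word ?t ` dom t = rank_word t ` dom t"
    by (rule image_cong[OF refl rank])
  then show "plane_of ?t = insert w' (plane_of t)"
    unfolding plane_of_def dom image_insert new by simp
  have "rank_word ?t ` active t = rank_word t ` active t"
    by (rule image_cong[OF refl rank]) (use active_subset_dom in blast)
  then show "rank_word ?t ` active ?t = insert w' (rank_word t ` active t)"
    unfolding active_attach image_insert new by simp
qed

section \<open>Local limits\<close>

lemma ball_of_dom: "u \<in> dom (ball_of h t) \<longleftrightarrow> u \<in> dom t \<and> length u \<le> h"
  by (auto simp: ball_of_def restrict_map_def split: if_splits)

lemma rank_word_ball_of:
  "length u \<le> h \<Longrightarrow> rank_word (ball_of h t) u = rank_word t u"
  unfolding rank_word_def by (rule map_cong) (auto simp: ball_of_dom)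

lemma plane_of_ball_of:
  "length w \<le> h \<Longrightarrow> w \<in> plane_of (ball_of h t) \<longleftrightarrow> w \<in> plane_of t"
  unfolding plane_of_def image_iff using ball_of_dom rank_word_ball_of length_rank_word by metis

lemma lf_tree_ball_of: "lf_tree t \<Longrightarrow> lf_tree (ball_of h t)"
  unfolding lf_tree_def ball_of_dom
  by (auto intro: finite_subset[of "{n. _ @ [n] \<in> dom t \<and> _}"])

lemma ball_of_eqI: "(\<And>u. length u \<le> h \<Longrightarrow> t u = t' u) \<Longrightarrow> ball_of h t = ball_of h t'"
  by (auto simp: ball_of_def restrict_map_def)

lemma ball_of_eqD: "ball_of h t = ball_of h t' \<Longrightarrow> length u \<le> h \<Longrightarrow> t u = t' u"
  unfolding ball_of_def by (metis mem_Collect_eq restrict_in)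

lemma converges_locally_unique:
  assumes "converges_locally T t" "converges_locally T t'"
  shows "t = t'"
proof
  fix u :: "nat list"
  have "\<forall>\<^sub>F n in sequentially. ball_of (Suc (length u)) (T n) = ball_of (Suc (length u)) t"
    "\<forall>\<^sub>F n in sequentially. ball_of (Suc (length u)) (T n) = ball_of (Suc (length u)) t'"
    using assms by (simp_all add: converges_locally_def)
  then have "\<forall>\<^sub>F n::nat in sequentially. ball_of (Suc (length u)) t = ball_of (Suc (length u)) t'"
    by eventually_elim simp
  then have "ball_of (Suc (length u)) t = ball_of (Suc (length u)) t'" by simp
  then show "t u = t' u" by (rule ball_of_eqD) simp
qed

lemma local_limit_eq: "converges_locally T t \<Longrightarrow> local_limit T = t"
  unfolding local_limit_def using converges_locally_unique by (auto intro!: the_equality)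

lemma converges_locally_local_limit:
  "\<exists>t. converges_locally T t \<Longrightarrow> converges_locally T (local_limit T)"
  using local_limit_eq by metis

lemma lf_tree_root: "lf_tree [[] \<mapsto> Active]"
  by (auto simp: lf_tree_def)

lemma lf_tree_local_limit: "lf_tree (local_limit T)"
proof (cases "\<exists>t. converges_locally T t")
  case True
  then show ?thesis using converges_locally_local_limit by (auto simp: converges_locally_def)
qed (simp add: local_limit_def lf_tree_root)

text \<open>A description of convergence that does not mention the limit. It serves both to prove convergence and
  to see that the set where it happens is measurable: it consists of countably many
  conditions, each on two trees of the sequence at most.\<close>

lemma converges_locally_iff:
  "(\<exists>t. converges_locally T t) \<longleftrightarrow>
    (\<forall>h\<ge>1. \<exists>N. lf_tree (ball_of h (T N)) \<and> (\<forall>n\<ge>N. ball_of h (T n) = ball_of h (T N)))"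
    (is "_ \<longleftrightarrow> ?R")
proof
  assume "\<exists>t. converges_locally T t"
  then obtain t where t: "lf_tree t"
    "\<And>h. h \<ge> 1 \<Longrightarrow> \<forall>\<^sub>F n in sequentially. ball_of h (T n) = ball_of h t"
    by (auto simp: converges_locally_def)
  show ?R
  proof (intro allI impI)
    fix h :: nat assume "h \<ge> 1"
    then obtain N where "\<forall>n\<ge>N. ball_of h (T n) = ball_of h t"
      using t(2) by (auto simp: eventually_sequentially)
    then show "\<exists>N. lf_tree (ball_of h (T N)) \<and> (\<forall>n\<ge>N. ball_of h (T n) = ball_of h (T N))"
      using lf_tree_ball_of[OF t(1)] by (intro exI[of _ N]) simp
  qed
next
  assume ?R
  then obtain N where N: "\<And>h. h \<ge> 1 \<Longrightarrow> lf_tree (ball_of h (T (N h)))"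
    "\<And>h n. h \<ge> 1 \<Longrightarrow> n \<ge> N h \<Longrightarrow> ball_of h (T n) = ball_of h (T (N h))"
    by metis
  \<comment> \<open>radius \<open>length u + 1\<close>, since only balls of radius at least \<open>1\<close> are controlled\<close>
  define t where "t u = T (N (Suc (length u))) u" for u
  have t: "T n u = t u" if "h \<ge> 1" "length u \<le> h" "n \<ge> N h" for h n u
  proof -
    have "T n u = T (N h) u" by (rule ball_of_eqD[OF N(2)]) (use that in auto)
    also have "\<dots> = T (max (N h) (N (Suc (length u)))) u"
      by (rule ball_of_eqD[OF N(2)[symmetric]]) (use that in auto)
    also have "\<dots> = t u"
      unfolding t_def by (rule ball_of_eqD[OF N(2)]) (use that in auto)
    finally show ?thesis .
  qed
  have ball: "ball_of h (T n) = ball_of h t" if "h \<ge> 1" "n \<ge> N h" for h n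
    by (rule ball_of_eqI) (use t that in auto)
  have lf: "lf_tree (ball_of h t)" if "h \<ge> 1" for h
    using N(1)[OF that] ball[OF that order_refl] by simp
  have "lf_tree t"
    unfolding lf_tree_def
  proof (intro conjI allI impI)
    show "[] \<in> dom t" using lf[of 1] unfolding lf_tree_def ball_of_dom by simp
    fix u
    show "u \<in> dom t" if "u @ [m] \<in> dom t" for m
      using lf_tree_parent[OF lf[of "Suc (length u)"], of u m] that by (simp add: ball_of_dom)
    have "finite {m. u @ [m] \<in> dom (ball_of (Suc (length u)) t)}"
      using lf[of "Suc (length u)"] by (simp add: lf_tree_def)
    then show "finite {m. u @ [m] \<in> dom t}" by (simp add: ball_of_dom)
  qed
  moreover have "\<forall>\<^sub>F n in sequentially. ball_of h (T n) = ball_of h t" if "h \<ge> 1" for h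
    using ball[OF that] by (auto simp: eventually_sequentially)
  ultimately show "\<exists>t. converges_locally T t" by (auto simp: converges_locally_def)
qed

lemma plane_of_local_limit_iff:
  assumes "converges_locally T t"
  shows "\<forall>\<^sub>F n in sequentially. w \<in> plane_of (T n) \<longleftrightarrow> w \<in> plane_of t"
proof -
  have "\<forall>\<^sub>F n in sequentially. ball_of (Suc (length w)) (T n) = ball_of (Suc (length w)) t"
    using assms by (simp add: converges_locally_def)
  then show ?thesis
  proof eventually_elim
    case (elim n)
    then show ?case using plane_of_ball_of[of w "Suc (length w)"] by (metis le_SucI order_refl)
  qed
qed

section \<open>The law of the history\<close>

text \<open>One step of the construction, driven by a pair (chosen vertex, sign). A history is the list of these
  pairs, the most recent one first; it ranges over a countable type, unlike the trees, so its law is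
  determined by the probabilities of single histories.\<close>

definition grow :: "nat \<Rightarrow> ltree \<Rightarrow> nat list \<times> int \<Rightarrow> ltree" where
  "grow n t z = (if active t = {} then t
     else if snd z = -1 then t(fst z \<mapsto> Frozen n) else t(fst z @ [n] \<mapsto> Active))"

primrec tree_of :: "(nat list \<times> int) list \<Rightarrow> ltree" where
  "tree_of [] = [[] \<mapsto> Active]"
| "tree_of (z # h) = grow (Suc (length h)) (tree_of h) z"

primrec valid_history :: "(nat list \<times> int) list \<Rightarrow> bool" where
  "valid_history [] \<longleftrightarrow> True"
| "valid_history (z # h) \<longleftrightarrow> valid_history h \<and>
     (active (tree_of h) \<noteq> {} \<longrightarrow> fst z \<in> active (tree_of h))"

lemma labelled_tree_mono: "labelled_tree n t \<Longrightarrow> n \<le> m \<Longrightarrow> labelled_tree m t"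
  unfolding labelled_tree_def by fastforce

lemma labelled_tree_tree_of: "valid_history h \<Longrightarrow> labelled_tree (length h) (tree_of h)"
proof (induction h)
  case (Cons z h)
  then show ?case
    by (auto simp: grow_def intro: labelled_tree_mono labelled_tree_freeze labelled_tree_attach)
qed (simp add: labelled_tree_root)

lemma finite_active: "labelled_tree n t \<Longrightarrow> finite (active t)"
  by (rule finite_subset[OF active_subset_dom]) (simp add: labelled_tree_def)

definition sign_pmf :: "real \<Rightarrow> int pmf" where
  "sign_pmf p = map_pmf (\<lambda>b. if b then 1 else -1) (bernoulli_pmf p)"

definition choice_pmf :: "ltree \<Rightarrow> nat list pmf" where
  "choice_pmf t = (if active t = {} then return_pmf [] else pmf_of_set (active t))"

text \<open>The law of the history, as a Markov chain. In a tree without active vertex the chosen vertex is the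
  fixed word \<open>[]\<close>: there the process \<open>V\<close> is arbitrary and might even reveal later signs.\<close>

primrec history_pmf :: "real \<Rightarrow> nat \<Rightarrow> (nat list \<times> int) list pmf" where
  "history_pmf p 0 = return_pmf []"
| "history_pmf p (Suc n) = bind_pmf (history_pmf p n)
     (\<lambda>h. map_pmf (\<lambda>z. z # h) (pair_pmf (choice_pmf (tree_of h)) (sign_pmf p)))"

lemma pmf_sign_pmf:
  assumes "0 \<le> p" "p \<le> 1"
  shows "pmf (sign_pmf p) x = (if x = 1 then p else if x = -1 then 1 - p else 0)"
proof -
  let ?s = "\<lambda>b. if b then 1 else -1 :: int"
  have inj: "inj ?s" by (auto simp: inj_def)
  have "pmf (sign_pmf p) (?s b) = (if b then p else 1 - p)" for b
    unfolding sign_pmf_def pmf_map_inj'[OF inj] using assms by simp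
  from this[of True] this[of False]
  have "pmf (sign_pmf p) 1 = p" "pmf (sign_pmf p) (-1) = 1 - p" by simp_all
  moreover have "pmf (sign_pmf p) x = 0" if "x \<noteq> 1" "x \<noteq> -1"
    using that by (auto simp: sign_pmf_def pmf_eq_0_set_pmf split: if_splits)
  ultimately show ?thesis by auto
qed

text \<open>A history determines its past, so only one term of the sum over the possible pasts is nonzero.\<close>

lemma pmf_history_pmf_Cons:
  "pmf (history_pmf p (Suc n)) (z # h) =
     pmf (history_pmf p n) h * pmf (pair_pmf (choice_pmf (tree_of h)) (sign_pmf p)) z"
proof -
  have zero: "pmf (map_pmf (\<lambda>z. z # h') q) (z # h) = 0" if "h' \<noteq> h" for h' and q :: "(nat list \<times> int) pmf"
    using that by (auto simp: pmf_eq_0_set_pmf)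
  have "inj (\<lambda>z. z # h)" by (simp add: inj_def)
  then have same: "pmf (map_pmf (\<lambda>z. z # h) q) (z # h) = pmf q z" for q
    by (rule pmf_map_inj')
  show ?thesis
    unfolding history_pmf.simps pmf_bind
    by (subst integral_measure_pmf[of "{h}"]) (auto simp: same, use zero in blast)
qed

lemma set_pmf_history_pmf:
  "h \<in> set_pmf (history_pmf p n) \<Longrightarrow> length h = n \<and> valid_history h"
proof (induction n arbitrary: h)
  case (Suc n)
  then obtain z h' where h: "h = z # h'" "h' \<in> set_pmf (history_pmf p n)"
    "fst z \<in> set_pmf (choice_pmf (tree_of h'))"
    by auto
  note IH = Suc.IH[OF h(2)]
  then have "finite (active (tree_of h'))"
    using finite_active labelled_tree_tree_of by blast
  then show ?case using h(1,3) IH by (cases "active (tree_of h') = {}") (auto simp: choice_pmf_def)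
qed simp

lemma integral_bind_pmf_bounded:
  fixes f :: "'b \<Rightarrow> real"
  assumes "\<And>x. \<bar>f x\<bar> \<le> B"
  shows "(\<integral>x. f x \<partial>bind_pmf q g) = (\<integral>x. (\<integral>y. f y \<partial>g x) \<partial>q)"
  unfolding measure_pmf_bind
  by (rule integral_bind[where K = "count_space UNIV" and B = B and B' = 1])
    (use assms in \<open>auto simp: measure_pmf.finite_measure_axioms measure_pmf.emeasure_space_1
      intro: measure_pmf_in_subprob_space\<close>)

lemma integral_history_pmf_Suc:
  fixes f :: "(nat list \<times> int) list \<Rightarrow> real"
  assumes p: "0 \<le> p" "p \<le> 1" and f: "\<And>h. \<bar>f h\<bar> \<le> B"
  shows "(\<integral>h. f h \<partial>history_pmf p (Suc n)) =
    (\<integral>h. (\<integral>v. p * f ((v, 1) # h) + (1 - p) * f ((v, -1) # h) \<partial>choice_pmf (tree_of h)) \<partial>history_pmf p n)"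
  unfolding history_pmf.simps pair_pmf_def
  by (simp add: integral_bind_pmf_bounded[of _ B] f sign_pmf_def map_pmf_def[symmetric]
      map_bind_pmf map_pmf_comp bind_map_pmf p mult.commute)

text \<open>The history of the given process, with the choices made after extinction replaced by \<open>[]\<close> as
  in \<open>history_pmf\<close>.\<close>

primrec history ::
    "(nat \<Rightarrow> 'a \<Rightarrow> int) \<Rightarrow> (nat \<Rightarrow> 'a \<Rightarrow> nat list) \<Rightarrow> nat \<Rightarrow> 'a \<Rightarrow> (nat list \<times> int) list" where
  "history X V 0 \<omega> = []"
| "history X V (Suc n) \<omega> =
     (if active (tree_of (history X V n \<omega>)) = {} then [] else V (Suc n) \<omega>, X (Suc n) \<omega>)
       # history X V n \<omega>"

lemma length_history [simp]: "length (history X V n \<omega>) = n"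
  by (induction n) auto

lemma tree_of_history: "tree_of (history X V n \<omega>) = uaf_tree (\<lambda>i. X i \<omega>) (\<lambda>i. V i \<omega>) n"
  by (induction n) (simp_all add: grow_def Let_def)

lemma measurable_history:
  assumes "\<And>i. 1 \<le> i \<Longrightarrow> i \<le> n \<Longrightarrow> X i \<in> measurable N (count_space UNIV)"
    and "\<And>i. 1 \<le> i \<Longrightarrow> i \<le> n \<Longrightarrow> V i \<in> measurable N (count_space UNIV)"
  shows "history X V n \<in> measurable N (count_space UNIV)"
  using assms
proof (induction n)
  case 0
  then show ?case by simp
next
  case (Suc n)
  have X: "X (Suc n) \<in> measurable N (count_space UNIV)" and
    V: "V (Suc n) \<in> measurable N (count_space UNIV)" using Suc.prems by simp_all
  have H: "history X V n \<in> measurable N (count_space UNIV)" by (rule Suc.IH) (use Suc.prems in auto)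
  define F where "F h v x = (if active (tree_of h) = {} then [] else v :: nat list, x :: int) # h"
    for h v x
  have "(\<lambda>\<omega>. F h v (X (Suc n) \<omega>)) \<in> measurable N (count_space UNIV)" for h v
    by (rule measurable_compose[OF X]) simp
  then have "(\<lambda>\<omega>. F h (V (Suc n) \<omega>) (X (Suc n) \<omega>)) \<in> measurable N (count_space UNIV)" for h
    by (rule measurable_compose_countable[OF _ V, of "\<lambda>v \<omega>. F h v (X (Suc n) \<omega>)"])
  then have "(\<lambda>\<omega>. F (history X V n \<omega>) (V (Suc n) \<omega>) (X (Suc n) \<omega>)) \<in> measurable N (count_space UNIV)"
    by (rule measurable_compose_countable[OF _ H, of "\<lambda>h \<omega>. F h (V (Suc n) \<omega>) (X (Suc n) \<omega>)"])
  then show ?case by (simp add: F_def)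
qed

locale uaf_process = prob_space M for M :: "'a measure" +
  fixes X :: "nat \<Rightarrow> 'a \<Rightarrow> int" and V :: "nat \<Rightarrow> 'a \<Rightarrow> nat list" and p :: real
  assumes p_nonneg: "0 \<le> p" and p_less_1: "p < 1"
    and indep_X: "indep_vars (\<lambda>_. count_space UNIV) X {1..}"
    and law_X: "i \<ge> 1 \<Longrightarrow> prob {\<omega> \<in> space M. X i \<omega> = x} = pmf (sign_pmf p) x"
    and choices: "uaf_choices M X V"
begin

lemma measurable_X: "i \<ge> 1 \<Longrightarrow> X i \<in> measurable M (count_space UNIV)"
  using indep_X by (auto simp: indep_vars_def)

lemma measurable_V: "i \<ge> 1 \<Longrightarrow> V i \<in> measurable M (count_space UNIV)"
  using choices by (auto simp: uaf_choices_def)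

lemma measurable_history_M [measurable]: "history X V n \<in> measurable M (count_space UNIV)"
  by (rule measurable_history) (auto intro: measurable_X measurable_V)

lemma past_generators:
  "{X i -` A \<inter> space M | i A. 1 \<le> i} \<union> {V i -` A \<inter> space M | i A. 1 \<le> i \<and> i < n} \<subseteq> sets M"
  using measurable_sets[OF measurable_X] measurable_sets[OF measurable_V] by auto

lemma space_past [simp]: "space (uaf_past M X V n) = space M"
  unfolding uaf_past_def by (simp add: space_measure_of_conv)

lemma sets_past: "sets (uaf_past M X V n) = sigma_sets (space M)
   ({X i -` A \<inter> space M | i A. 1 \<le> i} \<union> {V i -` A \<inter> space M | i A. 1 \<le> i \<and> i < n})"
  unfolding uaf_past_def
  by (rule sets_measure_of) auto

lemma subalgebra_past: "subalgebra M (uaf_past M X V n)"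
  unfolding subalgebra_def sets_past
  using sets.sigma_sets_subset[OF past_generators] by simp

lemma measurable_X_past: "1 \<le> i \<Longrightarrow> X i \<in> measurable (uaf_past M X V n) (count_space UNIV)"
  by (rule measurableI) (simp_all add: sets_past, rule sigma_sets.Basic, blast)

lemma measurable_V_past:
  "1 \<le> i \<Longrightarrow> i < n \<Longrightarrow> V i \<in> measurable (uaf_past M X V n) (count_space UNIV)"
  by (rule measurableI) (simp_all add: sets_past, rule sigma_sets.Basic, blast)

text \<open>On an event of the past that fixes the history, the conditional law of the next choice is a constant,
  and integrating the conditional expectation over this event multiplies its probability.\<close>

lemma prob_choice:
  assumes A: "A \<in> sets (uaf_past M X V (Suc n))" "A \<subseteq> {\<omega> \<in> space M. history X V n \<omega> = h}"
    and active: "active (tree_of h) \<noteq> {}"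
  shows "prob (A \<inter> {\<omega> \<in> space M. V (Suc n) \<omega> = v}) = prob A * pmf (choice_pmf (tree_of h)) v"
proof -
  let ?F = "uaf_past M X V (Suc n)" and ?S = "active (tree_of h)"
  let ?f = "indicator {\<omega> \<in> space M. V (Suc n) \<omega> = v} :: 'a \<Rightarrow> real"
  interpret finite_measure_subalgebra M ?F
    using finite_measure_axioms subalgebra_past
    by (simp add: finite_measure_subalgebra_def finite_measure_subalgebra_axioms_def)
  have AM: "A \<in> sets M" using A(1) subalgebra_past by (auto simp: subalgebra_def)
  have B: "{\<omega> \<in> space M. V (Suc n) \<omega> = v} \<in> sets M"
    using measurable_sets[OF measurable_V, of "Suc n" "{v}"] by (simp add: vimage_def Int_def conj_commute)
  have cond: "AE \<omega> in M. \<omega> \<in> A \<longrightarrow> real_cond_exp M ?F ?f \<omega> = pmf (pmf_of_set ?S) v"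
  proof -
    have "AE \<omega> in M. let S = active (uaf_tree (\<lambda>i. X i \<omega>) (\<lambda>i. V i \<omega>) n) in
        S \<noteq> {} \<longrightarrow> real_cond_exp M ?F ?f \<omega> = pmf (pmf_of_set S) v"
      using choices[unfolded uaf_choices_def, THEN conjunct2, rule_format, of "Suc n" v] by simp
    then show ?thesis
    proof eventually_elim
      case (elim \<omega>)
      show ?case
      proof
        assume "\<omega> \<in> A"
        then have "uaf_tree (\<lambda>i. X i \<omega>) (\<lambda>i. V i \<omega>) n = tree_of h"
          using A(2) tree_of_history[of X V n \<omega>] by auto
        then show "real_cond_exp M ?F ?f \<omega> = pmf (pmf_of_set ?S) v"
          using elim active by (simp add: Let_def)
      qed
    qed
  qed
  have "prob (A \<inter> {\<omega> \<in> space M. V (Suc n) \<omega> = v}) = (\<integral>\<omega>\<in>A. ?f \<omega> \<partial>M)"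
    using AM B by (simp add: set_lebesgue_integral_def indicator_inter_arith[symmetric])
  also have "\<dots> = (\<integral>\<omega>\<in>A. real_cond_exp M ?F ?f \<omega> \<partial>M)"
    by (rule real_cond_exp_intA) (use A B in \<open>auto intro!: integrable_real_indicator simp: less_top[symmetric]\<close>)
  also have "\<dots> = (\<integral>\<omega>\<in>A. pmf (pmf_of_set ?S) v \<partial>M)"
    by (rule set_lebesgue_integral_cong_AE) (use AM cond in auto)
  also have "\<dots> = prob A * pmf (choice_pmf (tree_of h)) v"
    using AM active by (simp add: set_integral_const choice_pmf_def)
  finally show ?thesis .
qed

lemma prob_steps:
  assumes "finite J" "J \<subseteq> {1..}"
  shows "prob {\<omega> \<in> space M. \<forall>i\<in>J. X i \<omega> = f i} = (\<Prod>i\<in>J. pmf (sign_pmf p) (f i))"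
proof (cases "J = {}")
  case True
  then show ?thesis by (simp add: prob_space)
next
  case False
  have "indep_sets (\<lambda>i. {X i -` A \<inter> space M | A. A \<in> sets (count_space UNIV)}) {1..}"
    using indep_X by (simp add: indep_vars_def2)
  then have "prob (\<Inter>i\<in>J. X i -` {f i} \<inter> space M) = (\<Prod>i\<in>J. prob (X i -` {f i} \<inter> space M))"
    by (rule indep_setsD) (use assms False in auto)
  moreover have "(\<Inter>i\<in>J. X i -` {f i} \<inter> space M) = {\<omega> \<in> space M. \<forall>i\<in>J. X i \<omega> = f i}"
    using False by auto
  moreover have "prob (X i -` {f i} \<inter> space M) = pmf (sign_pmf p) (f i)" if "i \<in> J" for i
    using law_X[of i "f i"] that assms(2) by (auto simp: vimage_def Int_def conj_commute)
  ultimately show ?thesis by simp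
qed

text \<open>The history up to time \<open>n\<close> is independent of the signs after time \<open>n\<close>. These signs have
  to be included in the induction, because the next sign must be independent of the history together
  with the next choice. It works since the choice is uniform conditionally on all signs, the future
  ones included.\<close>

lemma prob_history_steps:
  assumes "finite J" "J \<subseteq> {Suc n..}"
  shows "prob {\<omega> \<in> space M. history X V n \<omega> = h \<and> (\<forall>i\<in>J. X i \<omega> = f i)} =
    pmf (history_pmf p n) h * (\<Prod>i\<in>J. pmf (sign_pmf p) (f i))"
  using assms
proof (induction n arbitrary: h J f)
  case 0
  then show ?case using prob_steps[of J f] by (cases "h = []") (auto simp: indicator_def)
next
  case (Suc n)
  show ?case
  proof (cases h)
    case Nil
    have "[] \<notin> set_pmf (history_pmf p (Suc n))" using set_pmf_history_pmf[of "[]" p "Suc n"] by auto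
    then show ?thesis by (simp add: Nil pmf_eq_0_set_pmf del: history_pmf.simps)
  next
    case (Cons z h')
    obtain v x where z: "z = (v, x)" by (cases z)
    let ?t = "tree_of h'"
    \<comment> \<open>the past and the next sign are fixed first, and the choice is added by \<open>prob_choice\<close>\<close>
    define A where "A = {\<omega> \<in> space M. history X V n \<omega> = h' \<and>
      (\<forall>i\<in>insert (Suc n) J. X i \<omega> = (f(Suc n := x)) i)}"
    have "Suc n \<notin> J" using Suc.prems(2) by auto
    have "prob A = pmf (history_pmf p n) h' *
        (\<Prod>i\<in>insert (Suc n) J. pmf (sign_pmf p) ((f(Suc n := x)) i))"
      unfolding A_def by (rule Suc.IH) (use Suc.prems in auto)
    also have "(\<Prod>i\<in>insert (Suc n) J. pmf (sign_pmf p) ((f(Suc n := x)) i)) =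
        pmf (sign_pmf p) x * (\<Prod>i\<in>J. pmf (sign_pmf p) (f i))"
      using \<open>Suc n \<notin> J\<close> Suc.prems(1) by (simp, intro disjI2 prod.cong) auto
    finally have prob_A: "prob A = pmf (history_pmf p n) h' * pmf (sign_pmf p) x *
        (\<Prod>i\<in>J. pmf (sign_pmf p) (f i))" by simp
    have step: "prob {\<omega> \<in> A. (if active ?t = {} then [] else V (Suc n) \<omega>) = v} =
        prob A * pmf (choice_pmf ?t) v"
    proof (cases "active ?t = {}")
      case True
      then show ?thesis by (simp add: choice_pmf_def indicator_def)
    next
      case False
      have "A \<in> sets (uaf_past M X V (Suc n))"
      proof -
        have "history X V n \<in> measurable (uaf_past M X V (Suc n)) (count_space UNIV)"
          by (rule measurable_history) (auto intro: measurable_X_past measurable_V_past)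
        then have H: "{\<omega> \<in> space M. history X V n \<omega> = h'} \<in> sets (uaf_past M X V (Suc n))"
          using measurable_sets[of "history X V n" "uaf_past M X V (Suc n)" "count_space UNIV" "{h'}"]
          by (simp add: vimage_def Int_def conj_commute)
        have X: "{\<omega> \<in> space M. X i \<omega> = y} \<in> sets (uaf_past M X V (Suc n))" if "i \<ge> 1" for i y
          using measurable_sets[OF measurable_X_past[OF that], of "{y}" "Suc n"]
          by (simp add: vimage_def Int_def conj_commute)
        have "A = {\<omega> \<in> space M. history X V n \<omega> = h'} \<inter>
            (\<Inter>i\<in>insert (Suc n) J. {\<omega> \<in> space M. X i \<omega> = (f(Suc n := x)) i})"
          by (auto simp: A_def)
        also have "\<dots> \<in> sets (uaf_past M X V (Suc n))"
          by (intro sets.Int sets.finite_INT H X) (use Suc.prems in auto)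
        finally show ?thesis .
      qed
      then have "prob (A \<inter> {\<omega> \<in> space M. V (Suc n) \<omega> = v}) = prob A * pmf (choice_pmf ?t) v"
        by (rule prob_choice) (use False in \<open>auto simp: A_def\<close>)
      moreover have "A \<inter> {\<omega> \<in> space M. V (Suc n) \<omega> = v} =
          {\<omega> \<in> A. (if active ?t = {} then [] else V (Suc n) \<omega>) = v}"
        using False by (auto simp: A_def)
      ultimately show ?thesis by simp
    qed
    have "{\<omega> \<in> space M. history X V (Suc n) \<omega> = h \<and> (\<forall>i\<in>J. X i \<omega> = f i)} =
        {\<omega> \<in> A. (if active ?t = {} then [] else V (Suc n) \<omega>) = v}"
      using \<open>Suc n \<notin> J\<close> by (auto simp: A_def Cons z)
    then show ?thesis
      by (simp add: step prob_A Cons z pmf_history_pmf_Cons pmf_pair del: history_pmf.simps)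
  qed
qed

lemma distr_history: "distr M (count_space UNIV) (history X V n) = measure_pmf (history_pmf p n)"
proof (rule measure_eqI_countable[of _ UNIV])
  fix h
  have "emeasure (distr M (count_space UNIV) (history X V n)) {h} = prob {\<omega> \<in> space M. history X V n \<omega> = h}"
    by (subst emeasure_distr) (auto simp: vimage_def Int_def conj_commute emeasure_eq_measure)
  also have "\<dots> = emeasure (history_pmf p n) {h}"
    using prob_history_steps[of "{}" n h] by (simp add: emeasure_pmf_single)
  finally show "emeasure (distr M (count_space UNIV) (history X V n)) {h} =
    emeasure (history_pmf p n) {h}" .
qed auto

lemma expectation_history:
  fixes f :: "(nat list \<times> int) list \<Rightarrow> real"
  shows "expectation (\<lambda>\<omega>. f (history X V n \<omega>)) = (\<integral>h. f h \<partial>history_pmf p n)"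
  unfolding distr_history[symmetric] by (rule integral_distr[symmetric]) auto

lemma AE_valid_history: "AE \<omega> in M. \<forall>n. valid_history (history X V n \<omega>)"
proof -
  have "AE \<omega> in M. valid_history (history X V n \<omega>)" for n
  proof -
    have "AE h in distr M (count_space UNIV) (history X V n). valid_history h"
      unfolding distr_history AE_measure_pmf_iff using set_pmf_history_pmf by blast
    then show ?thesis by (subst (asm) AE_distr_iff) auto
  qed
  then show ?thesis by (simp add: AE_all_countable)
qed

end

section \<open>The likelihood of a cylinder\<close>

text \<open>The conditional probability that \<open>w\<close> ends up with \<open>j\<close> children, when the current plane tree
  is \<open>\<tau>\<close> with active vertices \<open>a\<close>: an active vertex with \<open>c\<close> children receives a
  geometric number of further ones, and an unborn vertex will start with none (if it is born at all).\<close>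

definition offspring_weight ::
    "real \<Rightarrow> nat \<Rightarrow> nat list set \<Rightarrow> nat list set \<Rightarrow> nat list \<Rightarrow> real" where
  "offspring_weight p j \<tau> a w =
     (if w \<notin> \<tau> then (1 - p) * p ^ j
      else if w \<in> a then
        (if num_children \<tau> w \<le> j then (1 - p) * p ^ (j - num_children \<tau> w) else 0)
      else of_bool (num_children \<tau> w = j))"

definition likelihood :: "real \<Rightarrow> nat list set \<Rightarrow> (nat list \<Rightarrow> nat) \<Rightarrow> ltree \<Rightarrow> real" where
  "likelihood p A k t =
     (\<Prod>w\<in>A. offspring_weight p (k w) (plane_of t) (rank_word t ` active t) w)"

lemma offspring_weight_bounds:
  assumes "0 \<le> p" "p \<le> 1"
  shows "0 \<le> offspring_weight p j \<tau> a w" "offspring_weight p j \<tau> a w \<le> 1"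
proof -
  have "(1 - p) * p ^ i \<le> 1" for i
    by (rule mult_le_one) (use assms in \<open>auto simp: power_le_one\<close>)
  then show "0 \<le> offspring_weight p j \<tau> a w" "offspring_weight p j \<tau> a w \<le> 1"
    using assms by (auto simp: offspring_weight_def)
qed

lemma likelihood_bounds:
  assumes "0 \<le> p" "p \<le> 1"
  shows "0 \<le> likelihood p A k t" "likelihood p A k t \<le> 1"
  unfolding likelihood_def using offspring_weight_bounds[OF assms]
  by (auto intro: prod_nonneg prod_le_1)

text \<open>Choosing \<open>w\<close> only changes the factor of \<open>w\<close>: the new vertex \<open>w'\<close> is active without
  children, which has the same weight as being unborn. The factor of \<open>w\<close> has the right mean because
  the geometric law is memoryless.\<close>

lemma prod_offspring_weight_mean:
  assumes \<tau>: "plane_tree \<tau>" "w \<in> \<tau>" and a: "w \<in> a" and A: "finite A"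
  defines "w' \<equiv> w @ [Suc (num_children \<tau> w)]"
  shows "p * (\<Prod>x\<in>A. offspring_weight p (k x) (insert w' \<tau>) (insert w' a) x) +
      (1 - p) * (\<Prod>x\<in>A. offspring_weight p (k x) \<tau> (a - {w}) x) =
    (\<Prod>x\<in>A. offspring_weight p (k x) \<tau> a x)"
proof -
  let ?c = "num_children \<tau> w" and ?\<tau>' = "insert w' \<tau>" and ?a' = "insert w' a"
  have new: "w' \<notin> \<tau>" using plane_tree_child_iff[OF \<tau>] by (simp add: w'_def)
  have c': "num_children ?\<tau>' w = Suc ?c"
    by (rule num_children_eqI) (auto simp: plane_tree_child_iff[OF \<tau>] w'_def)
  have leaf: "num_children ?\<tau>' w' = 0"
  proof (rule num_children_eqI)
    fix j :: nat assume "j \<ge> 1"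
    have "w' @ [j] \<notin> \<tau>" using new \<tau>(1) by (auto simp: plane_tree_def)
    then show "w' @ [j] \<in> ?\<tau>' \<longleftrightarrow> j \<le> 0" using \<open>j \<ge> 1\<close> by auto
  qed
  have attach: "offspring_weight p j ?\<tau>' ?a' x = offspring_weight p j \<tau> a x" if "x \<noteq> w" for j x
  proof (cases "x = w'")
    case True
    then show ?thesis using new leaf by (simp add: offspring_weight_def)
  next
    case False
    have "num_children ?\<tau>' x = num_children \<tau> x"
      using that by (simp add: num_children_def w'_def)
    then show ?thesis using False by (simp add: offspring_weight_def)
  qed
  have freeze: "offspring_weight p j \<tau> (a - {w}) x = offspring_weight p j \<tau> a x" if "x \<noteq> w" for j x
    using that by (simp add: offspring_weight_def)
  have mean: "p * offspring_weight p j ?\<tau>' ?a' w + (1 - p) * offspring_weight p j \<tau> (a - {w}) w =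
      offspring_weight p j \<tau> a w" for j
  proof (cases "?c < j")
    case True
    then have "j - ?c = Suc (j - Suc ?c)" by simp
    then show ?thesis using True \<tau>(2) a c' by (simp add: offspring_weight_def)
  qed (use \<tau>(2) a c' in \<open>auto simp: offspring_weight_def\<close>)
  show ?thesis
  proof (cases "w \<in> A")
    case True
    have rest: "(\<Prod>x\<in>A - {w}. offspring_weight p (k x) ?\<tau>' ?a' x) =
        (\<Prod>x\<in>A - {w}. offspring_weight p (k x) \<tau> a x)"
      "(\<Prod>x\<in>A - {w}. offspring_weight p (k x) \<tau> (a - {w}) x) =
        (\<Prod>x\<in>A - {w}. offspring_weight p (k x) \<tau> a x)"
      by (rule prod.cong[OF refl], use attach freeze in auto)+
    show ?thesis
      unfolding prod.remove[OF A True] rest mean[symmetric] by (simp add: algebra_simps)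
  next
    case False
    have "(\<Prod>x\<in>A. offspring_weight p (k x) ?\<tau>' ?a' x) = (\<Prod>x\<in>A. offspring_weight p (k x) \<tau> a x)"
      "(\<Prod>x\<in>A. offspring_weight p (k x) \<tau> (a - {w}) x) = (\<Prod>x\<in>A. offspring_weight p (k x) \<tau> a x)"
      by (rule prod.cong[OF refl], use False attach freeze in metis)+
    then show ?thesis by (simp add: algebra_simps)
  qed
qed

lemma likelihood_mean:
  assumes t: "labelled_tree n t" and v: "v \<in> active t" and A: "finite A"
  shows "p * likelihood p A k (t(v @ [Suc n] \<mapsto> Active)) +
    (1 - p) * likelihood p A k (t(v \<mapsto> Frozen l)) = likelihood p A k t"
proof -
  have "rank_word t v \<in> plane_of t"
    unfolding plane_of_def using v active_subset_dom by blast
  then show ?thesis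
    unfolding likelihood_def plane_of_freeze[OF t v] plane_of_attach[OF t v]
    using plane_tree_plane_of[OF labelled_tree_lf_tree[OF t]] v A
    by (intro prod_offspring_weight_mean) auto
qed

lemma plane_of_root: "plane_of [[] \<mapsto> Active] = {[]}"
  by (simp add: plane_of_def)

lemma likelihood_root: "likelihood p A k [[] \<mapsto> Active] = (\<Prod>w\<in>A. (1 - p) * p ^ k w)"
proof -
  have "num_children {[]} [] = 0" by (rule num_children_eqI) auto
  then show ?thesis
    unfolding likelihood_def plane_of_root
    by (intro prod.cong) (auto simp: offspring_weight_def active_def)
qed

text \<open>The mean is preserved for each choice of an active vertex, hence for any law of the choice.\<close>

lemma integral_likelihood:
  assumes p: "0 \<le> p" "p \<le> 1" and A: "finite A"
  shows "(\<integral>h. likelihood p A k (tree_of h) \<partial>history_pmf p n) = (\<Prod>w\<in>A. (1 - p) * p ^ k w)"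
proof (induction n)
  case 0
  then show ?case by (simp add: likelihood_root)
next
  case (Suc n)
  let ?L = "\<lambda>h. likelihood p A k (tree_of h)"
  have "(\<integral>h. ?L h \<partial>history_pmf p (Suc n)) =
    (\<integral>h. (\<integral>v. p * ?L ((v, 1) # h) + (1 - p) * ?L ((v, -1) # h) \<partial>choice_pmf (tree_of h)) \<partial>history_pmf p n)"
    by (rule integral_history_pmf_Suc[OF p, of _ 1]) (use likelihood_bounds[OF p] in \<open>simp add: abs_le_iff order_trans\<close>)
  also have "\<dots> = (\<integral>h. ?L h \<partial>history_pmf p n)"
  proof (intro integral_cong_AE AE_pmfI)
    fix h assume "h \<in> set_pmf (history_pmf p n)"
    then have h: "valid_history h" "length h = n" using set_pmf_history_pmf by auto
    note t = labelled_tree_tree_of[OF h(1)]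
    show "(\<integral>v. p * ?L ((v, 1) # h) + (1 - p) * ?L ((v, -1) # h) \<partial>choice_pmf (tree_of h)) = ?L h"
    proof (cases "active (tree_of h) = {}")
      case True
      then show ?thesis by (simp add: grow_def algebra_simps)
    next
      case False
      have "(\<integral>v. p * ?L ((v, 1) # h) + (1 - p) * ?L ((v, -1) # h) \<partial>choice_pmf (tree_of h)) =
          (\<integral>v. ?L h \<partial>choice_pmf (tree_of h))"
      proof (intro integral_cong_AE AE_pmfI)
        fix v assume "v \<in> set_pmf (choice_pmf (tree_of h))"
        then have "v \<in> active (tree_of h)"
          using False finite_active[OF t] by (simp add: choice_pmf_def)
        then show "p * ?L ((v, 1) # h) + (1 - p) * ?L ((v, -1) # h) = ?L h"
          using likelihood_mean[OF t _ A] False by (simp add: grow_def)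
      qed simp_all
      then show ?thesis by simp
    qed
  qed simp_all
  finally show ?case using Suc.IH by simp
qed

text \<open>Without active vertices, the weight of an unborn word is not the indicator that it should be. This is
  harmless: a word of \<open>A\<close> that is missing although its parent is present shows that the parent has
  too few children, so that another factor vanishes.\<close>

lemma prod_final_weights:
  assumes \<tau>: "plane_tree \<tau>" and coh: "coherent A k"
  shows "(\<Prod>w\<in>A. if w \<notin> \<tau> then (1 - p) * p ^ k w else of_bool (num_children \<tau> w = k w)) =
    (of_bool (\<tau> \<in> cylinder A k) :: real)"
proof (cases "\<exists>w\<in>A. w \<in> \<tau> \<and> num_children \<tau> w \<noteq> k w")
  case True
  then show ?thesis using coh by (auto simp: cylinder_def coherent_def intro!: prod_zero)
next
  case False
  have "w \<in> \<tau>" if "w \<in> A" for w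
    using that
  proof (induction w rule: rev_induct)
    case Nil
    then show ?case using \<tau> by (simp add: plane_tree_def)
  next
    case (snoc j u)
    then have "u \<in> A" "1 \<le> j" "j \<le> k u" using coh by (auto simp: coherent_def)
    moreover from this have "u \<in> \<tau>" using snoc.IH by simp
    ultimately show ?case using False plane_tree_child_iff[OF \<tau>] by force
  qed
  then show ?thesis using False \<tau> by (simp add: cylinder_def)
qed

section \<open>Every vertex is eventually frozen\<close>

text \<open>The product of the factors \<open>1 - c / n \<le> exp (- c / n)\<close> tends to \<open>0\<close> because the harmonic
  series diverges.\<close>

lemma tendsto_0_harmonic_decay:
  fixes a :: "nat \<Rightarrow> real"
  assumes nonneg: "\<And>n. 0 \<le> a n" and "c > 0"
    and step: "\<And>n. n \<ge> N \<Longrightarrow> a (Suc n) \<le> (1 - c / real (Suc n)) * a n"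
  shows "a \<longlonglongrightarrow> 0"
proof -
  \<comment> \<open>the constant makes the bound an equality at time \<open>N\<close>\<close>
  define b where "b n = a N * exp (c * harm N) * exp (- (c * harm n))" for n
  have bound: "a n \<le> b n" if "n \<ge> N" for n
    using that
  proof (induction n rule: dec_induct)
    case base
    then show ?case by (simp add: b_def mult.assoc flip: exp_add)
  next
    case (step n)
    have "a (Suc n) \<le> (1 - c / real (Suc n)) * a n" by (rule assms(3)[OF step.hyps(1)])
    also have "\<dots> \<le> exp (- c / real (Suc n)) * a n"
      using exp_ge_add_one_self[of "- c / real (Suc n)"] by (intro mult_right_mono nonneg) simp
    also have "\<dots> \<le> exp (- c / real (Suc n)) * b n"
      by (intro mult_left_mono step.IH) simp
    also have "\<dots> = b (Suc n)"
      by (simp add: b_def harm_Suc algebra_simps divide_inverse flip: exp_add)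
    finally show ?case .
  qed
  have "filterlim (\<lambda>n. c * harm n :: real) at_top sequentially"
    by (rule filterlim_tendsto_pos_mult_at_top[OF tendsto_const \<open>c > 0\<close> harm_at_top])
  then have "filterlim (\<lambda>n. - (c * harm n) :: real) at_bot sequentially"
    by (simp add: filterlim_uminus_at_bot)
  then have "(\<lambda>n. exp (- (c * harm n))) \<longlonglongrightarrow> 0"
    by (rule filterlim_compose[OF exp_at_bot])
  then have "b \<longlonglongrightarrow> 0" unfolding b_def by (rule tendsto_mult_right_zero)
  show ?thesis
    by (rule tendsto_sandwich[OF _ _ tendsto_const \<open>b \<longlonglongrightarrow> 0\<close>])
      (use nonneg bound in \<open>auto simp: eventually_sequentially\<close>)
qed

definition growth_step :: "nat \<Rightarrow> ltree \<Rightarrow> ltree \<Rightarrow> bool" where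
  "growth_step n t t' \<longleftrightarrow> t' = t \<or> (\<exists>v\<in>active t. \<exists>l. t' = t(v \<mapsto> Frozen l)) \<or>
     (\<exists>v\<in>active t. t' = t(v @ [n] \<mapsto> Active))"

lemma growth_step_active:
  "growth_step n t t' \<Longrightarrow> u \<in> active t' \<Longrightarrow> u \<in> active t \<or> (\<exists>v\<in>active t. u = v @ [n])"
  by (auto simp: growth_step_def active_def split: if_splits)

lemma growth_step_inactive:
  "growth_step n t t' \<Longrightarrow> u \<notin> active t \<Longrightarrow> u \<notin> active t' \<Longrightarrow> t' u = t u"
  by (auto simp: growth_step_def active_def split: if_splits)

text \<open>After a time at which no vertex of height less than \<open>h\<close> is active, no vertex of height \<open>h\<close>
  is born any more, and the finitely many existing ones become inactive in turn. Changes of the tree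
  only happen at active vertices or create an active vertex.\<close>

lemma stabilises_below_height:
  assumes fin: "\<And>n. finite (active (t n))"
    and step: "\<And>n. growth_step (Suc n) (t n) (t (Suc n))"
    and inactive: "\<And>u. \<exists>N. \<forall>n\<ge>N. u \<notin> active (t n)"
  shows "\<exists>N. \<forall>n\<ge>N. \<forall>u. length u < h \<longrightarrow> u \<notin> active (t n) \<and> t n u = t N u"
proof -
  have "\<exists>N. \<forall>n\<ge>N. \<forall>u. length u < h \<longrightarrow> u \<notin> active (t n)"
  proof (induction h)
    case (Suc h)
    then obtain N where N: "\<And>n u. n \<ge> N \<Longrightarrow> length u < h \<Longrightarrow> u \<notin> active (t n)" by blast
    have old: "u \<in> active (t N)" if "n \<ge> N" "u \<in> active (t n)" "length u < Suc h" for n u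
      using that
    proof (induction n rule: dec_induct)
      case (step n)
      have "u \<in> active (t n)"
        using growth_step_active[OF assms(2)[of n] step.prems(1)] step.prems(2) N[OF step.hyps(1)]
        by fastforce
      then show ?case using step by simp
    qed
    have "\<forall>\<^sub>F n in sequentially. \<forall>u\<in>active (t N). u \<notin> active (t n)"
      using inactive by (intro eventually_ball_finite fin) (simp add: eventually_sequentially)
    then obtain N' where "\<forall>n\<ge>N'. \<forall>u\<in>active (t N). u \<notin> active (t n)"
      by (auto simp: eventually_sequentially)
    then show ?case using old by (intro exI[of _ "max N N'"]) fastforce
  qed simp
  then obtain N where N: "\<And>n u. n \<ge> N \<Longrightarrow> length u < h \<Longrightarrow> u \<notin> active (t n)" by blast
  have "t n u = t N u" if "n \<ge> N" "length u < h" for n u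
    using that
  proof (induction n rule: dec_induct)
    case (step n)
    have "t (Suc n) u = t n u"
      by (rule growth_step_inactive[OF assms(2)]) (use N step.hyps step.prems in auto)
    then show ?case using step by simp
  qed simp
  then show ?thesis using N by blast
qed

lemma eventually_likelihood:
  assumes conv: "converges_locally T t" and coh: "coherent A k"
    and inactive: "\<And>h. \<forall>\<^sub>F n in sequentially. \<forall>u. length u < h \<longrightarrow> u \<notin> active (T n)"
  shows "\<forall>\<^sub>F n in sequentially. likelihood p A k (T n) = of_bool (plane_of t \<in> cylinder A k)"
proof -
  have "\<forall>\<^sub>F n in sequentially. \<forall>w\<in>A. offspring_weight p (k w) (plane_of (T n)) (rank_word (T n) ` active (T n)) w =
      (if w \<notin> plane_of t then (1 - p) * p ^ k w else of_bool (num_children (plane_of t) w = k w))"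
  proof (rule eventually_ball_finite)
    show "finite A" using coh by (simp add: coherent_def)
    show "\<forall>w\<in>A. \<forall>\<^sub>F n in sequentially. offspring_weight p (k w) (plane_of (T n)) (rank_word (T n) ` active (T n)) w =
      (if w \<notin> plane_of t then (1 - p) * p ^ k w else of_bool (num_children (plane_of t) w = k w))"
    proof
      fix w :: "nat list"
      have "\<forall>\<^sub>F n in sequentially. ball_of (Suc (length w)) (T n) = ball_of (Suc (length w)) t"
        using conv by (simp add: converges_locally_def)
      with inactive[of "Suc (length w)"]
      show "\<forall>\<^sub>F n in sequentially. offspring_weight p (k w) (plane_of (T n)) (rank_word (T n) ` active (T n)) w =
        (if w \<notin> plane_of t then (1 - p) * p ^ k w else of_bool (num_children (plane_of t) w = k w))"
      proof eventually_elim
        case (elim n)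
        have same: "x \<in> plane_of (T n) \<longleftrightarrow> x \<in> plane_of t" if "length x \<le> Suc (length w)" for x
          using plane_of_ball_of[OF that] elim(2) by metis
        then have "num_children (plane_of (T n)) w = num_children (plane_of t) w"
          by (simp add: num_children_def)
        moreover have "w \<notin> rank_word (T n) ` active (T n)" using elim(1) by auto
        ultimately show ?case using same[of w] by (simp add: offspring_weight_def)
      qed
    qed
  qed
  then show ?thesis
  proof eventually_elim
    case (elim n)
    have "likelihood p A k (T n) =
        (\<Prod>w\<in>A. if w \<notin> plane_of t then (1 - p) * p ^ k w else of_bool (num_children (plane_of t) w = k w))"
      unfolding likelihood_def by (rule prod.cong[OF refl]) (use elim in blast)
    then show ?case
      using prod_final_weights[OF plane_tree_plane_of coh] conv by (simp add: converges_locally_def)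
  qed
qed

lemma grow_growth_step:
  assumes "valid_history (z # h)"
  shows "growth_step (Suc (length h)) (tree_of h) (tree_of (z # h))"
  using assms by (auto simp: growth_step_def grow_def)

text \<open>A vertex can only be born at the time given by its last letter; after that it never becomes active
  again.\<close>

lemma active_Cons:
  assumes "valid_history h" "u = [] \<or> last u \<noteq> Suc (length h)" "u \<in> active (tree_of (z # h))"
  shows "u \<in> active (tree_of h)"
  using assms by (auto simp: grow_def active_freeze active_attach split: if_splits)

text \<open>An active vertex is chosen with probability \<open>1 / card (active t)\<close> and then frozen with probability
  \<open>1 - p\<close>.\<close>

lemma integral_active_step:
  assumes p: "0 \<le> p" "p \<le> 1" and h: "valid_history h" and u: "u = [] \<or> last u \<noteq> Suc (length h)"
  shows "(\<integral>v. p * of_bool (u \<in> active (tree_of ((v, 1) # h))) +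
        (1 - p) * of_bool (u \<in> active (tree_of ((v, -1) # h))) \<partial>choice_pmf (tree_of h))
    \<le> (1 - (1 - p) / real (Suc (length h))) * of_bool (u \<in> active (tree_of h))"
    (is "integral\<^sup>L _ ?f \<le> _")
proof (cases "u \<in> active (tree_of h)")
  case False
  then have "u \<notin> active (tree_of (z # h))" for z using active_Cons[OF h u] by blast
  then show ?thesis using False by (simp del: tree_of.simps)
next
  case True
  let ?S = "active (tree_of h)"
  note t = labelled_tree_tree_of[OF h]
  have S: "finite ?S" "?S \<noteq> {}" using finite_active[OF t] True by auto
  have f: "?f v = 1 - (if v = u then 1 - p else 0)" for v
    using True S(2) by (auto simp: grow_def active_freeze active_attach)
  have card: "0 < real (card ?S)" "real (card ?S) \<le> real (Suc (length h))"
    using S t by (auto simp: card_gt_0_iff labelled_tree_def)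
  have "integral\<^sup>L (choice_pmf (tree_of h)) ?f = (\<Sum>v\<in>?S. ?f v) / card ?S"
    using S by (simp add: choice_pmf_def integral_pmf_of_set del: tree_of.simps)
  also have "(\<Sum>v\<in>?S. ?f v) = card ?S - (1 - p)"
    unfolding f sum_subtractf using S True by simp
  also have "(card ?S - (1 - p)) / card ?S = 1 - (1 - p) / card ?S"
    using card by (simp add: diff_divide_distrib)
  also have "\<dots> \<le> 1 - (1 - p) / real (Suc (length h))"
    using card p by (intro diff_left_mono divide_left_mono) auto
  finally show ?thesis using True by simp
qed

context uaf_process
begin

abbreviation uaf :: "'a \<Rightarrow> nat \<Rightarrow> ltree" where
  "uaf \<omega> \<equiv> uaf_tree (\<lambda>i. X i \<omega>) (\<lambda>i. V i \<omega>)"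

lemma prob_active_tendsto_0:
  "(\<lambda>n. prob {\<omega> \<in> space M. u \<in> active (uaf \<omega> n)}) \<longlonglongrightarrow> 0"
proof (rule tendsto_0_harmonic_decay)
  have prob_eq: "prob {\<omega> \<in> space M. u \<in> active (uaf \<omega> n)} =
      (\<integral>h. of_bool (u \<in> active (tree_of h)) \<partial>history_pmf p n)" for n
  proof -
    have "{\<omega> \<in> space M. u \<in> active (uaf \<omega> n)} = history X V n -` {h. u \<in> active (tree_of h)} \<inter> space M"
      by (auto simp: tree_of_history)
    moreover have "\<dots> \<in> sets M" by measurable
    ultimately have "prob {\<omega> \<in> space M. u \<in> active (uaf \<omega> n)} =
        expectation (\<lambda>\<omega>. of_bool (u \<in> active (tree_of (history X V n \<omega>))))"
      by (subst Bochner_Integration.integral_cong[where g = "indicator {\<omega> \<in> space M. u \<in> active (uaf \<omega> n)}"])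
        (auto simp: tree_of_history)
    then show ?thesis
      using expectation_history[of "\<lambda>h. of_bool (u \<in> active (tree_of h))" n] by simp
  qed
  \<comment> \<open>from this time on, \<open>u\<close> can no longer be born\<close>
  fix n assume n: "n \<ge> (if u = [] then 0 else last u)"
  let ?f = "\<lambda>h. of_bool (u \<in> active (tree_of h)) :: real"
  have p: "0 \<le> p" "p \<le> 1" using p_nonneg p_less_1 by simp_all
  have "(\<integral>h. ?f h \<partial>history_pmf p (Suc n)) =
      (\<integral>h. (\<integral>v. p * ?f ((v, 1) # h) + (1 - p) * ?f ((v, -1) # h) \<partial>choice_pmf (tree_of h)) \<partial>history_pmf p n)"
    by (rule integral_history_pmf_Suc[OF p, of _ 1]) simp
  also have "\<dots> \<le> (\<integral>h. (1 - (1 - p) / real (Suc n)) * ?f h \<partial>history_pmf p n)"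
  proof (rule integral_mono_AE)
    show "integrable (history_pmf p n) (\<lambda>h. \<integral>v. p * ?f ((v, 1) # h) + (1 - p) * ?f ((v, -1) # h) \<partial>choice_pmf (tree_of h))"
    proof (rule measure_pmf.integrable_const_bound[where B = 1])
      have "\<bar>\<integral>v. p * ?f ((v, 1) # h) + (1 - p) * ?f ((v, -1) # h) \<partial>choice_pmf (tree_of h)\<bar> \<le> 1" for h
      proof -
        have bounds: "0 \<le> p * ?f ((v, 1) # h) + (1 - p) * ?f ((v, -1) # h)"
          "p * ?f ((v, 1) # h) + (1 - p) * ?f ((v, -1) # h) \<le> 1" for v
          using p by (auto simp: of_bool_def simp del: tree_of.simps)
        have "0 \<le> (\<integral>v. p * ?f ((v, 1) # h) + (1 - p) * ?f ((v, -1) # h) \<partial>choice_pmf (tree_of h))"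
          by (rule Bochner_Integration.integral_nonneg) (rule bounds)
        moreover have "(\<integral>v. p * ?f ((v, 1) # h) + (1 - p) * ?f ((v, -1) # h) \<partial>choice_pmf (tree_of h)) \<le> 1"
          by (rule measure_pmf.integral_le_const, rule measure_pmf.integrable_const_bound[where B = 1])
            (use bounds in \<open>simp_all del: tree_of.simps\<close>)
        ultimately show ?thesis by simp
      qed
      then show "AE h in history_pmf p n. norm (\<integral>v. p * ?f ((v, 1) # h) + (1 - p) * ?f ((v, -1) # h) \<partial>choice_pmf (tree_of h)) \<le> 1"
        by simp
    qed simp
    show "AE h in history_pmf p n. (\<integral>v. p * ?f ((v, 1) # h) + (1 - p) * ?f ((v, -1) # h) \<partial>choice_pmf (tree_of h))
        \<le> (1 - (1 - p) / real (Suc n)) * ?f h"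
    proof (rule AE_pmfI)
      fix h assume "h \<in> set_pmf (history_pmf p n)"
      then have h: "valid_history h" "length h = n" using set_pmf_history_pmf by auto
      moreover have "u = [] \<or> last u \<noteq> Suc (length h)" using n h(2) by (auto split: if_splits)
      ultimately show "(\<integral>v. p * ?f ((v, 1) # h) + (1 - p) * ?f ((v, -1) # h) \<partial>choice_pmf (tree_of h))
          \<le> (1 - (1 - p) / real (Suc n)) * ?f h"
        using integral_active_step[OF p h(1), of u] by simp
    qed
  qed (auto intro!: measure_pmf.integrable_const_bound[where B = 1])
  finally show "prob {\<omega> \<in> space M. u \<in> active (uaf \<omega> (Suc n))} \<le>
      (1 - (1 - p) / real (Suc n)) * prob {\<omega> \<in> space M. u \<in> active (uaf \<omega> n)}"
    unfolding prob_eq by simp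
qed (use p_less_1 in auto)

lemma measurable_history_pred: "Measurable.pred M (\<lambda>\<omega>. Q (history X V n \<omega>))"
  by (rule measurable_compose[OF measurable_history_M]) simp

lemma AE_eventually_inactive: "AE \<omega> in M. \<forall>u. \<exists>N. \<forall>n\<ge>N. u \<notin> active (uaf \<omega> n)"
proof -
  have "AE \<omega> in M. \<exists>N. \<forall>n\<ge>N. u \<notin> active (uaf \<omega> n)" for u
  proof -
    \<comment> \<open>no vertex named \<open>u\<close> is born after time \<open>l\<close>, so an inactive \<open>u\<close> stays inactive\<close>
    define l where "l = (if u = [] then 0 else last u)"
    define B where "B = {\<omega> \<in> space M. \<forall>n\<ge>l. u \<in> active (uaf \<omega> n)}"
    have sets: "{\<omega> \<in> space M. u \<in> active (uaf \<omega> n)} \<in> sets M" for n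
      using measurable_history_pred[of "\<lambda>h. u \<in> active (tree_of h)" n]
      by (simp add: tree_of_history pred_def)
    have "B = (\<Inter>n\<in>{l..}. {\<omega> \<in> space M. u \<in> active (uaf \<omega> n)})" by (auto simp: B_def)
    also have "\<dots> \<in> sets M" by (rule sets.countable_INT') (use sets in auto)
    finally have B: "B \<in> sets M" .
    have "prob B \<le> 0"
    proof (rule LIMSEQ_le_const[OF prob_active_tendsto_0[of u]], intro exI allI impI)
      fix n assume "l \<le> n"
      then show "prob B \<le> prob {\<omega> \<in> space M. u \<in> active (uaf \<omega> n)}"
        by (intro finite_measure_mono sets) (auto simp: B_def)
    qed
    then have "prob B = 0" by (simp add: measure_le_0_iff)
    then have "AE \<omega> in M. \<omega> \<notin> B" using B by (simp add: AE_iff_measurable[OF _ refl] prob_eq_0)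
    then show ?thesis
      using AE_valid_history AE_space
    proof eventually_elim
      case (elim \<omega>)
      then obtain n where n: "n \<ge> l" "u \<notin> active (uaf \<omega> n)" by (auto simp: B_def)
      have "u \<notin> active (uaf \<omega> m)" if "m \<ge> n" for m
        using that
      proof (induction m rule: dec_induct)
        case base
        then show ?case by (rule n(2))
      next
        case (step m)
        have "u = [] \<or> last u \<noteq> Suc (length (history X V m \<omega>))"
          using step.hyps n(1) by (auto simp: l_def split: if_splits)
        then show ?case
          using active_Cons[of "history X V m \<omega>" u] elim(2) step.IH history.simps(2)[of X V m \<omega>]
          by (metis tree_of_history)
      qed
      then show ?case by blast
    qed
  qed
  then show ?thesis by (simp add: AE_all_countable)
qed

lemma AE_stabilises:
  "AE \<omega> in M. converges_locally (uaf \<omega>) (local_limit (uaf \<omega>)) \<and>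
     (\<forall>h. \<forall>\<^sub>F n in sequentially. \<forall>u. length u < h \<longrightarrow> u \<notin> active (uaf \<omega> n))"
  using AE_valid_history AE_eventually_inactive
proof eventually_elim
  case (elim \<omega>)
  have tree: "labelled_tree n (uaf \<omega> n)" for n
    using labelled_tree_tree_of[of "history X V n \<omega>"] elim(1) by (simp add: tree_of_history)
  have step: "growth_step (Suc n) (uaf \<omega> n) (uaf \<omega> (Suc n))" for n
  proof -
    have "valid_history (history X V (Suc n) \<omega>)" using elim(1) by blast
    from grow_growth_step[OF this[unfolded history.simps(2)]]
    have "growth_step (Suc n) (tree_of (history X V n \<omega>)) (tree_of (history X V (Suc n) \<omega>))"
      by (simp only: history.simps(2) length_history)
    then show ?thesis by (simp only: tree_of_history)
  qed
  have stable: "\<exists>N. \<forall>n\<ge>N. \<forall>u. length u < h \<longrightarrow> u \<notin> active (uaf \<omega> n) \<and> uaf \<omega> n u = uaf \<omega> N u" for h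
    by (rule stabilises_below_height[of "uaf \<omega>", OF finite_active[OF tree] step])
      (rule elim(2)[rule_format])
  have "\<exists>t. converges_locally (uaf \<omega>) t"
    unfolding converges_locally_iff
  proof (intro allI impI)
    fix h :: nat
    obtain N where N: "\<forall>n\<ge>N. \<forall>u. length u < Suc h \<longrightarrow>
        u \<notin> active (uaf \<omega> n) \<and> uaf \<omega> n u = uaf \<omega> N u"
      using stable[of "Suc h"] by (rule exE)
    have "ball_of h (uaf \<omega> n) = ball_of h (uaf \<omega> N)" if "n \<ge> N" for n
      by (rule ball_of_eqI, rule N[rule_format, OF that, THEN conjunct2]) simp
    moreover have "lf_tree (ball_of h (uaf \<omega> N))"
      by (rule lf_tree_ball_of[OF labelled_tree_lf_tree[OF tree]])
    ultimately show "\<exists>N. lf_tree (ball_of h (uaf \<omega> N)) \<and>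
        (\<forall>n\<ge>N. ball_of h (uaf \<omega> n) = ball_of h (uaf \<omega> N))"
      by (intro exI[of _ N] conjI allI impI)
  qed
  moreover have "\<forall>\<^sub>F n in sequentially. \<forall>u. length u < h \<longrightarrow> u \<notin> active (uaf \<omega> n)" for h
  proof -
    obtain N where N: "\<forall>n\<ge>N. \<forall>u. length u < h \<longrightarrow> u \<notin> active (uaf \<omega> n) \<and> uaf \<omega> n u = uaf \<omega> N u"
      using stable[of h] by (rule exE)
    show ?thesis
      by (intro eventually_sequentiallyI[of N] allI impI) (rule N[rule_format, THEN conjunct1])
  qed
  ultimately show ?case by (intro conjI allI converges_locally_local_limit)
qed

section \<open>The law of the limit\<close>

lemma measurable_plane_limit: "(\<lambda>\<omega>. plane_of (local_limit (uaf \<omega>))) \<in> measurable M plane_trees"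
proof (rule measurable_plane_treesI)
  show "plane_tree (plane_of (local_limit (uaf \<omega>)))" for \<omega>
    by (rule plane_tree_plane_of[OF lf_tree_local_limit])
  fix w
  have pred1: "Measurable.pred M (\<lambda>\<omega>. Q (uaf \<omega> n))" for Q n
    using measurable_history_pred[of "\<lambda>h. Q (tree_of h)" n] by (simp add: tree_of_history)
  have pred2: "Measurable.pred M (\<lambda>\<omega>. Q (uaf \<omega> n) (uaf \<omega> m))" for Q n m
  proof -
    have "Measurable.pred M (\<lambda>\<omega>. Q (uaf \<omega> n) (tree_of (history X V m \<omega>)))"
      by (rule measurable_compose_countable[of "\<lambda>h \<omega>. Q (uaf \<omega> n) (tree_of h)"])
        (rule pred1 measurable_history_M)+
    then show ?thesis by (simp add: tree_of_history)
  qed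
  define conv where "conv \<omega> \<longleftrightarrow> (\<exists>t. converges_locally (uaf \<omega>) t)" for \<omega>
  have conv: "Measurable.pred M conv"
    unfolding conv_def[abs_def] converges_locally_iff
    by (intro pred_intros_countable pred_intros_logic pred1 pred2)
  have eq: "(\<lambda>\<omega>. w \<in> plane_of (local_limit (uaf \<omega>))) =
      (\<lambda>\<omega>. (conv \<omega> \<and> (\<exists>N. \<forall>n\<ge>N. w \<in> plane_of (uaf \<omega> n))) \<or> (\<not> conv \<omega> \<and> w = []))"
  proof
    fix \<omega>
    show "w \<in> plane_of (local_limit (uaf \<omega>)) \<longleftrightarrow>
      (conv \<omega> \<and> (\<exists>N. \<forall>n\<ge>N. w \<in> plane_of (uaf \<omega> n))) \<or> (\<not> conv \<omega> \<and> w = [])"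
    proof (cases "conv \<omega>")
      case True
      then have "converges_locally (uaf \<omega>) (local_limit (uaf \<omega>))"
        using converges_locally_local_limit by (simp add: conv_def)
      then have ev: "\<forall>\<^sub>F n in sequentially. w \<in> plane_of (uaf \<omega> n) \<longleftrightarrow> w \<in> plane_of (local_limit (uaf \<omega>))"
        by (rule plane_of_local_limit_iff)
      have "(\<forall>\<^sub>F n in sequentially. w \<in> plane_of (uaf \<omega> n)) \<longleftrightarrow> w \<in> plane_of (local_limit (uaf \<omega>))"
        using eventually_subst[OF ev] by simp
      then show ?thesis using True by (simp add: eventually_sequentially)
    next
      case False
      then show ?thesis by (simp add: conv_def local_limit_def plane_of_root)
    qed
  qed
  have "Measurable.pred M
      (\<lambda>\<omega>. (conv \<omega> \<and> (\<exists>N. \<forall>n\<ge>N. w \<in> plane_of (uaf \<omega> n))) \<or> (\<not> conv \<omega> \<and> w = []))"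
    by (intro pred_intros_countable pred_intros_logic pred1 conv)
  then have "Measurable.pred M (\<lambda>\<omega>. w \<in> plane_of (local_limit (uaf \<omega>)))"
    unfolding eq[symmetric] .
  then show "{\<omega> \<in> space M. w \<in> plane_of (local_limit (uaf \<omega>))} \<in> sets M"
    by (simp only: pred_def)
qed

lemma prob_cylinder:
  assumes coh: "coherent A k"
  shows "prob {\<omega> \<in> space M. plane_of (local_limit (uaf \<omega>)) \<in> cylinder A k} =
    (\<Prod>w\<in>A. (1 - p) * p ^ k w)"
proof -
  have p: "0 \<le> p" "p \<le> 1" using p_nonneg p_less_1 by simp_all
  have A: "finite A" using coh by (simp add: coherent_def)
  let ?L = "\<lambda>n \<omega>. likelihood p A k (uaf \<omega> n)"
  let ?E = "{\<omega> \<in> space M. plane_of (local_limit (uaf \<omega>)) \<in> cylinder A k}"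
  have E: "?E \<in> sets M"
    using measurable_sets[OF measurable_plane_limit sets_cylinder[OF A], of k]
    by (simp add: vimage_def Int_def conj_commute)
  have L: "expectation (?L n) = (\<Prod>w\<in>A. (1 - p) * p ^ k w)" for n
    using expectation_history[of "\<lambda>h. likelihood p A k (tree_of h)" n] integral_likelihood[OF p A, where k = k and n = n]
    by (simp add: tree_of_history)
  have "(\<lambda>n. expectation (?L n)) \<longlonglongrightarrow> expectation (indicator ?E)"
  proof (rule integral_dominated_convergence[where w = "\<lambda>_. 1"])
    show "indicator ?E \<in> borel_measurable M" using E by simp
    show "?L n \<in> borel_measurable M" for n
      using measurable_compose[OF measurable_history_M[of n], of "\<lambda>h. likelihood p A k (tree_of h)" borel]
      by (simp add: tree_of_history)
    show "AE \<omega> in M. (\<lambda>n. ?L n \<omega>) \<longlonglongrightarrow> indicator ?E \<omega>"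
      using AE_stabilises AE_space
    proof eventually_elim
      case (elim \<omega>)
      then have "\<forall>\<^sub>F n in sequentially. ?L n \<omega> = indicator ?E \<omega>"
        using eventually_likelihood[OF _ coh, of "uaf \<omega>" "local_limit (uaf \<omega>)" p]
        by (simp add: indicator_def of_bool_def)
      then show ?case by (rule tendsto_eventually)
    qed
    show "AE \<omega> in M. norm (?L n \<omega>) \<le> 1" for n
      using likelihood_bounds[OF p] by simp
  qed simp
  then have "(\<lambda>n::nat. \<Prod>w\<in>A. (1 - p) * p ^ k w) \<longlonglongrightarrow> prob ?E"
    using E by (simp add: L)
  then show ?thesis using LIMSEQ_unique tendsto_const by blast
qed

lemma bienayme_limit:
  assumes \<mu>: "\<And>k. pmf \<mu> k = (1 - p) * p ^ k"
  shows "bienayme_law \<mu> (distr M plane_trees (\<lambda>\<omega>. plane_of (local_limit (uaf \<omega>))))"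
proof (rule bienayme_lawI)
  show "prob_space (distr M plane_trees (\<lambda>\<omega>. plane_of (local_limit (uaf \<omega>))))"
    by (rule prob_space_distr[OF measurable_plane_limit])
  fix A k assume coh: "coherent A k"
  have "measure (distr M plane_trees (\<lambda>\<omega>. plane_of (local_limit (uaf \<omega>)))) (cylinder A k) =
      prob {\<omega> \<in> space M. plane_of (local_limit (uaf \<omega>)) \<in> cylinder A k}"
    using coh by (subst measure_distr[OF measurable_plane_limit sets_cylinder])
      (auto simp: coherent_def vimage_def Int_def conj_commute)
  then show "measure (distr M plane_trees (\<lambda>\<omega>. plane_of (local_limit (uaf \<omega>)))) (cylinder A k) =
      (\<Prod>w\<in>A. pmf \<mu> (k w))"
    by (simp add: prob_cylinder[OF coh] \<mu>)
qed simp

end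

theorem theorem2:
  fixes M :: "'a measure"
    and X :: "nat \<Rightarrow> 'a \<Rightarrow> int"
    and V :: "nat \<Rightarrow> 'a \<Rightarrow> nat list"
    and p :: real
    and \<mu> :: "nat pmf"
    and T :: "'a \<Rightarrow> nat \<Rightarrow> ltree"
    and T_inf :: "'a \<Rightarrow> ltree"
  assumes "prob_space M"
    and "0 \<le> p" and "p < 1"
    and "prob_space.indep_vars M (\<lambda>_. count_space UNIV) X {1..}"
    and "\<And>i. i \<ge> 1 \<Longrightarrow> distr M (count_space UNIV) (X i) = distr M (count_space UNIV) (X 1)"
    and "\<P>(\<omega> in M. X 1 \<omega> = 1) = p"
    and "\<P>(\<omega> in M. X 1 \<omega> = -1) = 1 - p"
    and "uaf_choices M X V"
    and "\<And>k. pmf \<mu> k = (1 - p) * p ^ k"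
  defines "T \<equiv> \<lambda>\<omega>. uaf_tree (\<lambda>i. X i \<omega>) (\<lambda>i. V i \<omega>)"
    and "T_inf \<equiv> \<lambda>\<omega>. local_limit (T \<omega>)"
  shows "(AE \<omega> in M. converges_locally (T \<omega>) (T_inf \<omega>)) \<and>
         (\<lambda>\<omega>. plane_of (T_inf \<omega>)) \<in> measurable M plane_trees \<and>
         bienayme_law \<mu> (distr M plane_trees (\<lambda>\<omega>. plane_of (T_inf \<omega>)))"
proof -
  interpret prob_space M by fact
  have X: "X i \<in> measurable M (count_space UNIV)" if "i \<ge> 1" for i
    using assms(4) that by (auto simp: indep_vars_def)
  have X_sets: "{\<omega> \<in> space M. X i \<omega> = x} \<in> sets M" if "i \<ge> 1" for i x
    using measurable_sets[OF X[OF that], of "{x}"] by (simp add: vimage_def Int_def conj_commute)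
  have identical: "prob {\<omega> \<in> space M. X i \<omega> = x} = prob {\<omega> \<in> space M. X 1 \<omega> = x}"
    if "i \<ge> 1" for i x
  proof -
    have "measure (distr M (count_space UNIV) (X j)) {x} = prob {\<omega> \<in> space M. X j \<omega> = x}"
      if "j \<ge> 1" for j
      using measure_distr[OF X[OF that], of "{x}"] by (simp add: vimage_def Int_def conj_commute)
    then show ?thesis using assms(5)[OF that] that by (metis le_refl)
  qed
  have law_1: "prob {\<omega> \<in> space M. X 1 \<omega> = x} = pmf (sign_pmf p) x" for x
  proof (cases "x = 1 \<or> x = -1")
    case True
    then show ?thesis using assms(2,3,6,7) by (auto simp: pmf_sign_pmf)
  next
    case False
    let ?B = "\<lambda>x. {\<omega> \<in> space M. X 1 \<omega> = x}"
    have "prob (?B 1 \<union> ?B (-1) \<union> ?B x) = prob (?B 1) + prob (?B (-1)) + prob (?B x)"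
      using X_sets[of 1] False by (subst finite_measure_Union; (subst finite_measure_Union)?) auto
    then have "prob (?B x) \<le> 0"
      using prob_le_1[of "?B 1 \<union> ?B (-1) \<union> ?B x"] assms(6,7) by simp
    then show ?thesis using False assms(2,3) by (simp add: pmf_sign_pmf measure_le_0_iff)
  qed
  interpret uaf_process M X V p
  proof
    show "prob {\<omega> \<in> space M. X i \<omega> = x} = pmf (sign_pmf p) x" if "i \<ge> 1" for i x
      by (rule trans[OF identical[OF that] law_1])
  qed (fact assms(2,3,4,8))+
  have "AE \<omega> in M. converges_locally (uaf \<omega>) (local_limit (uaf \<omega>))"
    using AE_stabilises by eventually_elim simp
  then show ?thesis
    unfolding T_inf_def T_def
    using measurable_plane_limit bienayme_limit[OF assms(9)] by blast
qed

end
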